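(* Let $B$ be one of the following unital complex algebras: the algebra $M_n$ of all complex $n\times n$ matrices; the algebra $\widetilde{F(X)}$, where $X$ is a complex linear space; or any unital algebra generated (as a unital algebra) by one element. Then for every unital $B$-bimodule $\mathcal{X}$ one has $\mathcal{D}_{Lie}(\mathcal{X},B)=\mathcal{M}_{Lie}(\mathcal{X},B)$.
   Context: $F(X)$ is the algebra of all finite-rank linear operators on $X$, and $\widetilde{F(X)}=F(X)+\mathbb{C}1$ inside the algebra of all linear operators on $X$. For a $B$-bimodule $\mathcal{X}$ and $a\in B$, let $L_a,R_a$ be the operators $L_a x=ax$, $R_a x=xa$ on $\mathcal{X}$. $\mathcal{D}_{Lie}(\mathcal{X},B)$ is the algebra of linear operators on $\mathcal{X}$ generated (without adjoining the identity) by all inner derivations $\delta_a=L_a-R_a$, $a\in B$. $\mathcal{M}_{Lie}(\mathcal{X},B)$ is the algebra of all elementary operators on $\mathcal{X}$ that can be written as $\sum_{k=1}^m L_{a_k}R_{b_k}$ with $a_k,b_k\in B$, $\sum_k a_kb_k=0$ and $\sum_k b_ka_k=0$. *)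

theory Defs
  imports Complex_Main "HOL-Algebra.Module" "Jordan_Normal_Form.Matrix"
begin

text \<open>
  Algebras are records of type \<open>(complex, 'a) module\<close> from \<open>HOL-Algebra\<close>, so that they have
  explicit carriers and need not be commutative (unlike in the locale \<open>algebra\<close> there).  Spaces on
  which operators act are whole types with an explicit complex scalar multiplication, as in
  \<open>HOL.Vector_Spaces\<close>; operators are then plain functions.
\<close>

definition complex_ring :: "complex ring" where
  "complex_ring = \<lparr>carrier = UNIV, mult = (*), one = 1, zero = 0, add = (+)\<rparr>"

locale unital_algebra = A?: ring A + V?: Module.module complex_ring A for A (structure) +
  assumes smult_mult_left:
      "\<lbrakk>x \<in> carrier A; y \<in> carrier A\<rbrakk> \<Longrightarrow> (c \<odot> x) \<otimes> y = c \<odot> (x \<otimes> y)"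
    and smult_mult_right:
      "\<lbrakk>x \<in> carrier A; y \<in> carrier A\<rbrakk> \<Longrightarrow> x \<otimes> (c \<odot> y) = c \<odot> (x \<otimes> y)"

text \<open>Subalgebras are not required to contain the unit.\<close>

definition subalgebra :: "(complex, 'a) module \<Rightarrow> 'a set \<Rightarrow> bool" where
  "subalgebra A S \<longleftrightarrow> S \<subseteq> carrier A \<and> \<zero>\<^bsub>A\<^esub> \<in> S \<and>
     (\<forall>x\<in>S. \<forall>y\<in>S. x \<oplus>\<^bsub>A\<^esub> y \<in> S) \<and>
     (\<forall>c. \<forall>x\<in>S. c \<odot>\<^bsub>A\<^esub> x \<in> S) \<and>
     (\<forall>x\<in>S. \<forall>y\<in>S. x \<otimes>\<^bsub>A\<^esub> y \<in> S)"

definition singly_generated :: "(complex, 'a) module \<Rightarrow> bool" where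
  "singly_generated A \<longleftrightarrow> (\<exists>a\<in>carrier A. subalgebra A hull {\<one>\<^bsub>A\<^esub>, a} = carrier A)"

definition matrix_algebra :: "nat \<Rightarrow> (complex, complex mat) module" where
  "matrix_algebra n = \<lparr>carrier = carrier_mat n n, mult = (*), one = 1\<^sub>m n,
     zero = 0\<^sub>m n n, add = (+), smult = (\<cdot>\<^sub>m)\<rparr>"

definition operator_algebra ::
  "(complex \<Rightarrow> 'v \<Rightarrow> 'v) \<Rightarrow> (complex, 'v::ab_group_add \<Rightarrow> 'v) module" where
  "operator_algebra s = \<lparr>carrier = {T. Vector_Spaces.linear s s T}, mult = (\<circ>), one = id,
     zero = (\<lambda>x. 0), add = (\<lambda>S T x. S x + T x), smult = (\<lambda>c T x. s c (T x))\<rparr>"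

definition finite_rank_operators ::
  "('k::field \<Rightarrow> 'v \<Rightarrow> 'v) \<Rightarrow> ('v::ab_group_add \<Rightarrow> 'v) set" where
  "finite_rank_operators s =
     {T. Vector_Spaces.linear s s T \<and> (\<exists>F. finite F \<and> range T = Modules.module.span s F)}"

definition finite_rank_unitization ::
  "(complex \<Rightarrow> 'v \<Rightarrow> 'v) \<Rightarrow> (complex, 'v::ab_group_add \<Rightarrow> 'v) module" where
  "finite_rank_unitization s = (operator_algebra s)
     \<lparr>carrier := {\<lambda>x. T x + s c x | T c. T \<in> finite_rank_operators s}\<rparr>"

locale unital_bimodule = unital_algebra B + vector_space scale
  for B :: "(complex, 'b) module" (structure)
    and scale :: "complex \<Rightarrow> 'v::ab_group_add \<Rightarrow> 'v" +
  fixes lact :: "'b \<Rightarrow> 'v \<Rightarrow> 'v" and ract :: "'v \<Rightarrow> 'b \<Rightarrow> 'v"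
  assumes lact_linear: "a \<in> carrier B \<Longrightarrow> Vector_Spaces.linear scale scale (\<lambda>x. lact a x)"
    and ract_linear: "a \<in> carrier B \<Longrightarrow> Vector_Spaces.linear scale scale (\<lambda>x. ract x a)"
    and lact_add: "\<lbrakk>a \<in> carrier B; b \<in> carrier B\<rbrakk> \<Longrightarrow> lact (a \<oplus> b) x = lact a x + lact b x"
    and ract_add: "\<lbrakk>a \<in> carrier B; b \<in> carrier B\<rbrakk> \<Longrightarrow> ract x (a \<oplus> b) = ract x a + ract x b"
    and lact_smult: "a \<in> carrier B \<Longrightarrow> lact (c \<odot> a) x = scale c (lact a x)"
    and ract_smult: "a \<in> carrier B \<Longrightarrow> ract x (c \<odot> a) = scale c (ract x a)"
    and lact_mult: "\<lbrakk>a \<in> carrier B; b \<in> carrier B\<rbrakk> \<Longrightarrow> lact (a \<otimes> b) x = lact a (lact b x)"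
    and ract_mult: "\<lbrakk>a \<in> carrier B; b \<in> carrier B\<rbrakk> \<Longrightarrow> ract x (a \<otimes> b) = ract (ract x a) b"
    and lact_ract: "\<lbrakk>a \<in> carrier B; b \<in> carrier B\<rbrakk> \<Longrightarrow> ract (lact a x) b = lact a (ract x b)"
    and lact_one: "lact \<one> x = x"
    and ract_one: "ract x \<one> = x"

definition inner_derivation ::
  "('b \<Rightarrow> 'v \<Rightarrow> 'v) \<Rightarrow> ('v \<Rightarrow> 'b \<Rightarrow> 'v) \<Rightarrow> 'b \<Rightarrow> 'v \<Rightarrow> 'v::ab_group_add" where
  "inner_derivation lact ract a = (\<lambda>x. lact a x - ract x a)"

definition D_Lie :: "(complex, 'b) module \<Rightarrow> (complex \<Rightarrow> 'v \<Rightarrow> 'v) \<Rightarrow>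
    ('b \<Rightarrow> 'v \<Rightarrow> 'v) \<Rightarrow> ('v \<Rightarrow> 'b \<Rightarrow> 'v) \<Rightarrow> ('v::ab_group_add \<Rightarrow> 'v) set" where
  "D_Lie B scale lact ract =
     subalgebra (operator_algebra scale) hull (inner_derivation lact ract ` carrier B)"

text \<open>
  The operator \<open>L\<^sub>a R\<^sub>b\<close> is \<open>x \<mapsto> a (x b)\<close>.  The empty sum (\<open>m = 0\<close>) only contributes the zero
  operator, which is also obtained from \<open>m = 1\<close>.
\<close>

definition M_Lie :: "(complex, 'b) module \<Rightarrow>
    ('b \<Rightarrow> 'v \<Rightarrow> 'v) \<Rightarrow> ('v \<Rightarrow> 'b \<Rightarrow> 'v) \<Rightarrow> ('v::ab_group_add \<Rightarrow> 'v) set" where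
  "M_Lie B lact ract = {\<lambda>x. \<Sum>k=1..m. lact (a k) (ract x (b k)) | (m::nat) a b.
     a \<in> {1..m} \<rightarrow> carrier B \<and> b \<in> {1..m} \<rightarrow> carrier B \<and>
     (\<Oplus>\<^bsub>B\<^esub>k\<in>{1..m}. a k \<otimes>\<^bsub>B\<^esub> b k) = \<zero>\<^bsub>B\<^esub> \<and>
     (\<Oplus>\<^bsub>B\<^esub>k\<in>{1..m}. b k \<otimes>\<^bsub>B\<^esub> a k) = \<zero>\<^bsub>B\<^esub>}"

text \<open>
  Since \<open>unital_bimodule\<close> includes the axioms of \<open>unital_algebra\<close>, it could only hold vacuously for
  matrices and for finite-rank operators if these were not unital algebras; the lemmas
  \<open>unital_algebra_matrix_algebra\<close> and \<open>unital_algebra_finite_rank_unitization\<close> rule this out.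
\<close>

lemma cring_complex_ring: "cring complex_ring"
proof -
  have "\<exists>y. x + y = 0 \<and> y + x = 0" for x :: complex
    by (rule exI[of _ "- x"]) simp
  then show ?thesis
    by unfold_locales
      (auto simp: complex_ring_def algebra_simps Units_def add_eq_0_iff)
qed

lemma unital_algebraI:
  fixes A (structure)
  assumes "ring A"
    and "\<And>c x. x \<in> carrier A \<Longrightarrow> c \<odot> x \<in> carrier A"
    and "\<And>c d x. x \<in> carrier A \<Longrightarrow> (c + d) \<odot> x = c \<odot> x \<oplus> d \<odot> x"
    and "\<And>c x y. \<lbrakk>x \<in> carrier A; y \<in> carrier A\<rbrakk> \<Longrightarrow> c \<odot> (x \<oplus> y) = c \<odot> x \<oplus> c \<odot> y"
    and "\<And>c d x. x \<in> carrier A \<Longrightarrow> (c * d) \<odot> x = c \<odot> (d \<odot> x)"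
    and "\<And>x. x \<in> carrier A \<Longrightarrow> 1 \<odot> x = x"
    and "\<And>c x y. \<lbrakk>x \<in> carrier A; y \<in> carrier A\<rbrakk> \<Longrightarrow> (c \<odot> x) \<otimes> y = c \<odot> (x \<otimes> y)"
    and "\<And>c x y. \<lbrakk>x \<in> carrier A; y \<in> carrier A\<rbrakk> \<Longrightarrow> x \<otimes> (c \<odot> y) = c \<odot> (x \<otimes> y)"
  shows "unital_algebra A"
proof -
  have "Module.module complex_ring A"
    by (rule Module.moduleI)
      (use assms cring_complex_ring in \<open>auto simp: complex_ring_def ring.is_abelian_group\<close>)
  with assms show ?thesis
    by (simp add: unital_algebra_def unital_algebra_axioms_def)
qed

lemma smult_smult_mat: "(c * d) \<cdot>\<^sub>m A = c \<cdot>\<^sub>m (d \<cdot>\<^sub>m (A :: complex mat))"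
  by (rule eq_matI) auto

lemma unital_algebra_matrix_algebra: "unital_algebra (matrix_algebra n)"
proof (rule unital_algebraI)
  show "ring (matrix_algebra n)"
    by (unfold_locales, insert add_inv_exists_mat,
        auto simp: matrix_algebra_def algebra_simps Units_def)
qed (auto simp: matrix_algebra_def add_smult_distrib_right_mat add_smult_distrib_left_mat
    smult_smult_mat mult_smult_assoc_mat mult_smult_distrib)

context vector_space
begin

lemma finite_rank_operatorsI:
  assumes "Vector_Spaces.linear scale scale T" "finite F" "range T \<subseteq> span F"
  shows "T \<in> finite_rank_operators scale"
proof -
  interpret T: Vector_Spaces.linear scale scale T by fact
  have sub: "subspace (range T)"
    by (rule T.subspace_image[OF subspace_UNIV])
  obtain C where C: "C \<subseteq> range T" "independent C" "range T \<subseteq> span C"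
    using basis_exists by metis
  have "finite C"
    using independent_span_bound[OF assms(2) C(2)] C(1) assms(3) by auto
  moreover have "range T = span C"
    using C(1,3) sub span_minimal by blast
  ultimately show ?thesis
    using assms(1) unfolding finite_rank_operators_def by auto
qed

lemma operator_simps:
  assumes "Vector_Spaces.linear scale scale T"
  shows "T (x + y) = T x + T y" "T (scale c x) = scale c (T x)" "T 0 = 0"
proof -
  interpret T: Vector_Spaces.linear scale scale T by fact
  show "T (x + y) = T x + T y" "T (scale c x) = scale c (T x)" "T 0 = 0"
    by (rule T.add T.scale T.zero)+
qed

lemma operatorI:
  assumes "\<And>x y. T (x + y) = T x + T y" "\<And>c x. T (scale c x) = scale c (T x)"
  shows "Vector_Spaces.linear scale scale T"
  by unfold_locales (use assms in auto)

lemma finite_rank_operatorsE: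
  assumes "T \<in> finite_rank_operators scale"
  obtains F where "Vector_Spaces.linear scale scale T" "finite F" "\<And>x. T x \<in> span F"
  using assms unfolding finite_rank_operators_def by blast

lemma finite_rank_zero: "(\<lambda>x. 0) \<in> finite_rank_operators scale"
  by (rule finite_rank_operatorsI[where F = "{}"]) (auto intro: operatorI simp: span_zero)

lemma finite_rank_add:
  assumes "S \<in> finite_rank_operators scale" "T \<in> finite_rank_operators scale"
  shows "(\<lambda>x. S x + T x) \<in> finite_rank_operators scale"
proof -
  obtain F where F: "Vector_Spaces.linear scale scale S" "finite F" "\<And>x. S x \<in> span F"
    by (rule finite_rank_operatorsE[OF assms(1)]) (rule that)
  obtain G where G: "Vector_Spaces.linear scale scale T" "finite G" "\<And>x. T x \<in> span G"
    by (rule finite_rank_operatorsE[OF assms(2)]) (rule that)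
  have "S x + T x \<in> span (F \<union> G)" for x
    by (intro span_add) (meson F(3) G(3) span_mono subsetD Un_upper1 Un_upper2)+
  then show ?thesis
    using F(1,2) G(1,2)
    by (intro finite_rank_operatorsI[where F = "F \<union> G"] operatorI)
      (auto simp: operator_simps scale_right_distrib algebra_simps)
qed

lemma finite_rank_scale:
  assumes "T \<in> finite_rank_operators scale"
  shows "(\<lambda>x. scale c (T x)) \<in> finite_rank_operators scale"
proof -
  obtain F where F: "Vector_Spaces.linear scale scale T" "finite F" "\<And>x. T x \<in> span F"
    by (rule finite_rank_operatorsE[OF assms]) (rule that)
  show ?thesis
    using F
    by (intro finite_rank_operatorsI[where F = F] operatorI)
      (auto simp: operator_simps scale_right_distrib scale_left_commute intro: span_scale)
qed

lemma finite_rank_comp: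
  assumes "S \<in> finite_rank_operators scale" "Vector_Spaces.linear scale scale T"
  shows "(\<lambda>x. S (T x)) \<in> finite_rank_operators scale"
proof -
  obtain F where F: "Vector_Spaces.linear scale scale S" "finite F" "\<And>x. S x \<in> span F"
    by (rule finite_rank_operatorsE[OF assms(1)]) (rule that)
  show ?thesis
    using F assms(2)
    by (intro finite_rank_operatorsI[where F = F] operatorI) (auto simp: operator_simps)
qed

end

lemma unital_algebra_finite_rank_unitization:
  assumes "vector_space scale"
  shows "unital_algebra (finite_rank_unitization scale)"
proof -
  interpret vector_space scale by fact
  let ?F = "finite_rank_operators scale"
  let ?C = "{\<lambda>x. T x + scale c x | T c. T \<in> ?F}"
  have F_linear: "Vector_Spaces.linear scale scale T" if "T \<in> ?F" for T
    using that by (rule finite_rank_operatorsE)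
  have CI: "(\<lambda>x. f x) \<in> ?C" if "T \<in> ?F" "\<And>x. f x = T x + scale c x" for f T c
    using that by blast
  have C_linear: "Vector_Spaces.linear scale scale T" if "T \<in> ?C" for T
    using that F_linear
    by (auto intro!: operatorI simp: operator_simps scale_right_distrib scale_left_commute)
  have C_zero: "(\<lambda>x. 0) \<in> ?C"
    by (rule CI[where c = 0, OF finite_rank_zero]) simp
  have C_one: "id \<in> ?C"
    using CI[where c = 1 and f = id, OF finite_rank_zero] by (simp add: id_def)
  have C_add: "(\<lambda>x. S x + T x) \<in> ?C" if ST: "S \<in> ?C" "T \<in> ?C" for S T
  proof -
    obtain S' c where S: "S = (\<lambda>x. S' x + scale c x)" "S' \<in> ?F" using ST by blast
    obtain T' d where T: "T = (\<lambda>x. T' x + scale d x)" "T' \<in> ?F" using ST by blast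
    show ?thesis
      by (rule CI[where c = "c + d", OF finite_rank_add[OF S(2) T(2)]])
        (simp add: S T scale_left_distrib algebra_simps)
  qed
  have C_scale: "(\<lambda>x. scale c (T x)) \<in> ?C" if T: "T \<in> ?C" for c T
  proof -
    obtain T' d where T: "T = (\<lambda>x. T' x + scale d x)" "T' \<in> ?F" using T by blast
    show ?thesis
      by (rule CI[where c = "c * d", OF finite_rank_scale[OF T(2), of c]])
        (simp add: T scale_right_distrib)
  qed
  have C_comp: "S \<circ> T \<in> ?C" if ST: "S \<in> ?C" "T \<in> ?C" for S T
  proof -
    obtain S' c where S: "S = (\<lambda>x. S' x + scale c x)" "S' \<in> ?F" using ST by blast
    obtain T' d where T: "T = (\<lambda>x. T' x + scale d x)" "T' \<in> ?F" using ST by blast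
    have "(\<lambda>x. S' (T x) + scale c (T' x)) \<in> ?F"
      by (rule finite_rank_add[OF finite_rank_comp[OF S(2) C_linear[OF ST(2)]] finite_rank_scale[OF T(2)]])
    then have "(\<lambda>x. (S \<circ> T) x) \<in> ?C"
      by (rule CI[where c = "c * d"]) (simp add: S T scale_right_distrib add.assoc)
    then show ?thesis
      by (simp add: comp_def)
  qed
  have C_neg: "\<exists>T'\<in>?C. (\<lambda>x. T' x + T x) = (\<lambda>x. 0)" if T: "T \<in> ?C" for T
    by (rule bexI[OF _ C_scale[OF T, of "-1"]]) simp
  define C where "C = ?C"
  note C_closed = C_linear C_zero C_one C_add C_scale C_comp C_neg
  note C = C_closed[folded C_def]
  have fields: "carrier (finite_rank_unitization scale) = C"
    "mult (finite_rank_unitization scale) = (\<circ>)"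
    "one (finite_rank_unitization scale) = id"
    "zero (finite_rank_unitization scale) = (\<lambda>x. 0)"
    "add (finite_rank_unitization scale) = (\<lambda>S T x. S x + T x)"
    "smult (finite_rank_unitization scale) = (\<lambda>c T x. scale c (T x))"
    by (simp_all add: finite_rank_unitization_def operator_algebra_def C_def)
  have comp_add: "T \<circ> (\<lambda>x. R x + S x) = (\<lambda>x. (T \<circ> R) x + (T \<circ> S) x)"
    and comp_scale: "T \<circ> (\<lambda>x. scale c (R x)) = (\<lambda>x. scale c ((T \<circ> R) x))"
    if "T \<in> C" for R S T c
    by (simp_all add: fun_eq_iff operator_simps(1,2)[OF C(1)[OF that]])
  have "ring (finite_rank_unitization scale)"
  proof (rule ringI)
    show "abelian_group (finite_rank_unitization scale)"
      by (rule abelian_groupI; simp only: fields)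
        (simp_all add: C(2,4,7) add.assoc, simp add: add.commute)
    show "Group.monoid (finite_rank_unitization scale)"
      by (rule monoidI; simp only: fields) (simp_all only: C(3,6) comp_assoc id_comp comp_id)
  qed (simp_all only: fields comp_add, simp add: fun_eq_iff)
  then show ?thesis
    by (rule unital_algebraI; simp only: fields)
      (simp_all add: C(5) comp_scale scale_left_distrib scale_right_distrib,
        simp_all add: comp_def)
qed

end

(*
  Write [a,b] for the operator x |-> a x b, so that [a,b][c,d] = [ac,db].  That D_Lie is contained
  in M_Lie holds for every B: M_Lie is an algebra and contains the inner derivations.

  If B is generated by g, put d(i,j) = [g^(i+1),g^j] - [g^i,g^(j+1)].  By induction on n = i+j all
  d(i,j) lie in D_Lie: the difference of two neighbours is delta_g composed with an earlier one, and
  the sum over i+j = n telescopes to the inner derivation of g^(n+1), so (n+1) d(i,j) is in D_Lie.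
  Every [a,b] is congruent to [1,ab] modulo these elements.

  In the other two cases B has a minimal idempotent p with p B p = C p, and, up to scalars, finitely
  many elements of B are sums of rank one elements x f with x in Bp and f in pB.  With f x = <f,x> p,
  the operator [x g, y f] behaves like z |-> tr(u z) v for u = y g, v = x f.  Those with u and v of
  trace zero are in D_Lie: for a nilpotent n of rank one, [n,n] = -(1/2) delta_n^2, and composing with
  inner derivations on either side moves v and u through the adjoint module generated by n, which
  consists of all elements of trace zero.  The two linear conditions defining M_Lie cancel what
  remains, except for operators of the form [1,c], which are handled by idempotents c = q using
  delta_q^2 - delta_q = 2 ([1,q] - [q,q]).
*)

theory Submission
  imports Defs "HOL-Library.Function_Algebras"
begin

section \<open>Elementary operators on a bimodule\<close>

context unital_algebra
begin

lemma scalar_closed [simp, intro]: "x \<in> carrier A \<Longrightarrow> c \<odot> x \<in> carrier A"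
  using smult_closed[of c x] by (simp add: complex_ring_def)

lemma scalar_add_left: "x \<in> carrier A \<Longrightarrow> (c + d) \<odot> x = c \<odot> x \<oplus> d \<odot> x"
  using smult_l_distr[of c d x] by (simp add: complex_ring_def)

lemma scalar_add_right:
  "x \<in> carrier A \<Longrightarrow> y \<in> carrier A \<Longrightarrow> c \<odot> (x \<oplus> y) = c \<odot> x \<oplus> c \<odot> y"
  using smult_r_distr[of c x y] by (simp add: complex_ring_def)

lemma scalar_scalar: "x \<in> carrier A \<Longrightarrow> c \<odot> (d \<odot> x) = (c * d) \<odot> x"
  using smult_assoc1[of c d x] by (simp add: complex_ring_def)

lemma scalar_one [simp]: "x \<in> carrier A \<Longrightarrow> 1 \<odot> x = x"
  using smult_one[of x] by (simp add: complex_ring_def)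

lemma scalar_zero_left [simp]: "x \<in> carrier A \<Longrightarrow> 0 \<odot> x = \<zero>"
  using smult_l_null[of x] by (simp add: complex_ring_def)

lemma scalar_zero_right [simp]: "c \<odot> \<zero> = \<zero>"
  using smult_r_null[of c] by (simp add: complex_ring_def)

lemma scalar_minus_one: "x \<in> carrier A \<Longrightarrow> (- 1) \<odot> x = \<ominus> x"
  using scalar_add_left[of x "- 1" 1] by (simp add: A.minus_equality)

lemma scalar_eq_zero_iff: "x \<in> carrier A \<Longrightarrow> c \<odot> x = \<zero> \<longleftrightarrow> c = 0 \<or> x = \<zero>"
  by (metis left_inverse scalar_one scalar_scalar scalar_zero_left scalar_zero_right)

lemma scalar_cancel:
  assumes "x \<in> carrier A" "x \<noteq> \<zero>" "c \<odot> x = d \<odot> x"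
  shows "c = d"
proof -
  have "(c + - d) \<odot> x = (d + - d) \<odot> x"
    by (simp only: scalar_add_left[OF assms(1)] assms(3))
  then show ?thesis
    using assms by (simp add: scalar_eq_zero_iff)
qed

text \<open>Sums over lists allow induction on the terms of an elementary operator;
  \<open>list_sum_upt\<close> leads back to the indexed sums in \<open>M_Lie\<close>.\<close>

definition list_sum :: "'a list \<Rightarrow> 'a" where
  "list_sum xs = foldr (\<oplus>) xs \<zero>"

lemma list_sum_simps [simp]: "list_sum [] = \<zero>" "list_sum (x # xs) = x \<oplus> list_sum xs"
  by (simp_all add: list_sum_def)

lemma list_sum_closed [simp, intro]: "set xs \<subseteq> carrier A \<Longrightarrow> list_sum xs \<in> carrier A"
  by (induction xs) auto

lemma list_sum_append:
  "set xs \<subseteq> carrier A \<Longrightarrow> set ys \<subseteq> carrier A \<Longrightarrow> list_sum (xs @ ys) = list_sum xs \<oplus> list_sum ys"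
  by (induction xs) (auto simp: A.a_assoc)

lemma list_sum_upt:
  "f \<in> {1..m} \<rightarrow> carrier A \<Longrightarrow> list_sum (map f [1..<Suc m]) = (\<Oplus>k\<in>{1..m}. f k)"
proof (induction m)
  case (Suc m)
  then have f: "f \<in> {1..m} \<rightarrow> carrier A" "f (Suc m) \<in> carrier A"
    by auto
  have "[1..<Suc (Suc m)] = [1..<Suc m] @ [Suc m]"
    by simp
  then have "list_sum (map f [1..<Suc (Suc m)]) = list_sum (map f [1..<Suc m]) \<oplus> f (Suc m)"
    using f by (simp only: map_append, subst list_sum_append) (auto simp: Pi_iff)
  also have "\<dots> = (\<Oplus>k\<in>{1..m}. f k) \<oplus> f (Suc m)"
    using f by (simp only: Suc.IH)
  also have "\<dots> = (\<Oplus>k\<in>insert (Suc m) {1..m}. f k)"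
    using f by (simp add: A.finsum_insert A.a_comm)
  also have "insert (Suc m) {1..m} = {1..Suc m}"
    by auto
  finally show ?case .
qed simp

end

lemma vector_space_fun:
  assumes "vector_space scale"
  shows "vector_space (\<lambda>c (T :: 'a \<Rightarrow> 'v::ab_group_add) x. scale c (T x))"
proof -
  interpret vector_space scale by fact
  show ?thesis
    by unfold_locales (auto simp: fun_eq_iff scale_right_distrib scale_left_distrib)
qed

text \<open>A named constant for pointwise scaling lets the space of all functions, linear or not,
  be interpreted as the vector space \<open>ops\<close>, with the addition from
  \<open>Function_Algebras\<close>; facts on subspaces then apply to \<open>D\<close>.\<close>

definition scale_op :: "(complex \<Rightarrow> 'v \<Rightarrow> 'v) \<Rightarrow> complex \<Rightarrow> ('v \<Rightarrow> 'v) \<Rightarrow> 'v \<Rightarrow> 'v" where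
  "scale_op scale c T = (\<lambda>x. scale c (T x))"

context vector_space
begin

lemma operator_diff:
  assumes "Vector_Spaces.linear scale scale T"
  shows "T (x - y) = T x - T y"
  using operator_simps(1)[OF assms, of "x - y" y] by simp

end

context unital_bimodule
begin

sublocale ops: vector_space "scale_op scale"
  using vector_space_fun[OF vector_space_axioms] by (simp add: scale_op_def[abs_def])

definition elem_op :: "'b \<Rightarrow> 'b \<Rightarrow> 'v \<Rightarrow> 'v" where
  "elem_op a b = (\<lambda>x. lact a (ract x b))"

abbreviation "D \<equiv> D_Lie B scale lact ract"
abbreviation "\<delta> \<equiv> inner_derivation lact ract"

lemma lact_simps:
  assumes "a \<in> carrier B"
  shows "lact a (x + y) = lact a x + lact a y" "lact a (scale c x) = scale c (lact a x)"
    "lact a 0 = 0"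
  by (rule operator_simps[OF lact_linear[OF assms]])+

lemma ract_simps:
  assumes "a \<in> carrier B"
  shows "ract (x + y) a = ract x a + ract y a" "ract (scale c x) a = scale c (ract x a)"
    "ract 0 a = 0"
  by (rule operator_simps[OF ract_linear[OF assms]])+

lemma elem_op_linear:
  "a \<in> carrier B \<Longrightarrow> b \<in> carrier B \<Longrightarrow> Vector_Spaces.linear scale scale (elem_op a b)"
  by (rule operatorI) (simp_all add: elem_op_def lact_simps ract_simps)

lemma elem_op_add_left:
  "\<lbrakk>a \<in> carrier B; a' \<in> carrier B; b \<in> carrier B\<rbrakk>
    \<Longrightarrow> elem_op (a \<oplus> a') b = elem_op a b + elem_op a' b"
  by (simp add: elem_op_def lact_add fun_eq_iff)

lemma elem_op_add_right:
  "\<lbrakk>a \<in> carrier B; b \<in> carrier B; b' \<in> carrier B\<rbrakk>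
    \<Longrightarrow> elem_op a (b \<oplus> b') = elem_op a b + elem_op a b'"
  by (simp add: elem_op_def ract_add lact_simps fun_eq_iff)

lemma elem_op_scale_left:
  "a \<in> carrier B \<Longrightarrow> b \<in> carrier B \<Longrightarrow> elem_op (c \<odot> a) b = scale_op scale c (elem_op a b)"
  by (simp add: elem_op_def lact_smult scale_op_def)

lemma elem_op_scale_right:
  "a \<in> carrier B \<Longrightarrow> b \<in> carrier B \<Longrightarrow> elem_op a (c \<odot> b) = scale_op scale c (elem_op a b)"
  by (simp add: elem_op_def ract_smult lact_simps scale_op_def)

lemma elem_op_zero [simp]:
  "b \<in> carrier B \<Longrightarrow> elem_op \<zero> b = 0" "a \<in> carrier B \<Longrightarrow> elem_op a \<zero> = 0"
  using elem_op_scale_left[of \<zero> b 0] elem_op_scale_right[of a \<zero> 0] by simp_all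

lemma elem_op_minus_left:
  "a \<in> carrier B \<Longrightarrow> b \<in> carrier B \<Longrightarrow> elem_op (\<ominus> a) b = - elem_op a b"
  using elem_op_scale_left[of a b "- 1"] by (simp add: scalar_minus_one)

lemma elem_op_comp:
  "\<lbrakk>a \<in> carrier B; b \<in> carrier B; c \<in> carrier B; d \<in> carrier B\<rbrakk>
    \<Longrightarrow> elem_op a b \<circ> elem_op c d = elem_op (a \<otimes> c) (d \<otimes> b)"
  by (simp add: elem_op_def lact_mult ract_mult lact_ract fun_eq_iff)

lemma inner_derivation_eq: "a \<in> carrier B \<Longrightarrow> \<delta> a = elem_op a \<one> - elem_op \<one> a"
  by (simp add: inner_derivation_def elem_op_def lact_one ract_one fun_eq_iff)

lemma inner_derivation_linear:
  assumes "a \<in> carrier B"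
  shows "Vector_Spaces.linear scale scale (\<delta> a)"
  by (rule operatorI)
    (simp_all add: inner_derivation_def lact_simps[OF assms] ract_simps[OF assms] scale_right_diff_distrib)

lemma D_subalgebra: "subalgebra (operator_algebra scale) D"
proof -
  \<comment> \<open>A hull is an intersection, so the algebra of all linear operators must be
    exhibited as one of the sets intersected before \<open>D\<close> is known to lie in it.\<close>
  have "subalgebra (operator_algebra scale) (carrier (operator_algebra scale))"
    by (auto simp: subalgebra_def operator_algebra_def o_def intro!: operatorI
      simp: operator_simps algebra_simps scale_right_distrib)
  moreover have "\<delta> ` carrier B \<subseteq> carrier (operator_algebra scale)"
    using inner_derivation_linear by (auto simp: operator_algebra_def)
  ultimately have "D \<subseteq> carrier (operator_algebra scale)"
    unfolding D_Lie_def by (rule hull_minimal[rotated])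
  then show ?thesis
    unfolding D_Lie_def hull_def subalgebra_def by blast
qed

lemma inner_derivation_in_D: "a \<in> carrier B \<Longrightarrow> \<delta> a \<in> D"
  unfolding D_Lie_def by (simp add: hull_inc)

lemma D_subspace: "ops.subspace D"
  using D_subalgebra
  by (auto simp: subalgebra_def operator_algebra_def ops.subspace_def scale_op_def plus_fun_def zero_fun_def)

lemmas D_zero = ops.subspace_0[OF D_subspace]
  and D_add = ops.subspace_add[OF D_subspace]
  and D_diff = ops.subspace_diff[OF D_subspace]
  and D_neg = ops.subspace_neg[OF D_subspace]
  and D_scale = ops.subspace_scale[OF D_subspace]
  and D_sum = ops.subspace_sum[OF D_subspace]

lemma D_comp: "S \<in> D \<Longrightarrow> T \<in> D \<Longrightarrow> S \<circ> T \<in> D"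
  using D_subalgebra by (auto simp: subalgebra_def operator_algebra_def)

lemma D_scale_cancel: "scale_op scale c T \<in> D \<Longrightarrow> c \<noteq> 0 \<Longrightarrow> T \<in> D"
  using D_scale[of "scale_op scale c T" "inverse c"] by simp

lemma D_diff_cong: "S - T \<in> D \<Longrightarrow> S \<in> D \<longleftrightarrow> T \<in> D"
  using D_add[of "S - T" T] D_diff[of S "S - T"] by auto

end

section \<open>Elementary operators as images of tensors\<close>

lemma sum_fun_apply: "(sum f I) x = (\<Sum>i\<in>I. f i x)"
  for f :: "'i \<Rightarrow> 'a \<Rightarrow> 'v::ab_group_add"
  by (induction I rule: infinite_finite_induct) simp_all

context unital_bimodule
begin

text \<open>A list stands for a tensor, the sum of its terms a \<otimes> b. Lists are kept apart
  from their operators because the conditions of \<open>M_Lie\<close> concern a representation, and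
  one operator can have several.\<close>

definition pairs_op :: "('b \<times> 'b) list \<Rightarrow> 'v \<Rightarrow> 'v" where
  "pairs_op ps = (\<Sum>(a, b)\<leftarrow>ps. elem_op a b)"

definition pairs_prod :: "('b \<times> 'b) list \<Rightarrow> 'b" where
  "pairs_prod ps = list_sum (map (\<lambda>(a, b). a \<otimes> b) ps)"

definition pairs_rev_prod :: "('b \<times> 'b) list \<Rightarrow> 'b" where
  "pairs_rev_prod ps = list_sum (map (\<lambda>(a, b). b \<otimes> a) ps)"

lemma pairs_simps [simp]:
  "pairs_op [] = 0" "pairs_op ((a, b) # ps) = elem_op a b + pairs_op ps"
  "pairs_prod [] = \<zero>" "pairs_prod ((a, b) # ps) = a \<otimes> b \<oplus> pairs_prod ps"
  "pairs_rev_prod [] = \<zero>" "pairs_rev_prod ((a, b) # ps) = b \<otimes> a \<oplus> pairs_rev_prod ps"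
  by (simp_all add: pairs_op_def pairs_prod_def pairs_rev_prod_def)

lemma pairs_closed [simp, intro]:
  assumes "set ps \<subseteq> carrier B \<times> carrier B"
  shows "pairs_prod ps \<in> carrier B" "pairs_rev_prod ps \<in> carrier B"
  using assms by (induction ps) auto

lemma pairs_append:
  assumes "set ps \<subseteq> carrier B \<times> carrier B" "set qs \<subseteq> carrier B \<times> carrier B"
  shows "pairs_op (ps @ qs) = pairs_op ps + pairs_op qs"
    "pairs_prod (ps @ qs) = pairs_prod ps \<oplus> pairs_prod qs"
    "pairs_rev_prod (ps @ qs) = pairs_rev_prod ps \<oplus> pairs_rev_prod qs"
  using assms by (induction ps) (auto simp: A.a_assoc add.assoc)

text \<open>This is multiplication in B tensored with its opposite algebra, hence the order
  \<open>d \<otimes> b\<close>; it represents the composition of the operators.\<close>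

definition tensor_mult :: "('b \<times> 'b) list \<Rightarrow> ('b \<times> 'b) list \<Rightarrow> ('b \<times> 'b) list" where
  "tensor_mult ps qs = concat (map (\<lambda>(a, b). map (\<lambda>(c, d). (a \<otimes> c, d \<otimes> b)) qs) ps)"

lemma tensor_mult_simps [simp]:
  "tensor_mult [] qs = []"
  "tensor_mult ((a, b) # ps) qs = map (\<lambda>(c, d). (a \<otimes> c, d \<otimes> b)) qs @ tensor_mult ps qs"
  by (simp_all add: tensor_mult_def)

lemma map_tensor:
  assumes "a \<in> carrier B" "b \<in> carrier B" "set qs \<subseteq> carrier B \<times> carrier B"
  defines "rs \<equiv> map (\<lambda>(c, d). (a \<otimes> c, d \<otimes> b)) qs"
  shows "set rs \<subseteq> carrier B \<times> carrier B"
    and "pairs_op rs = elem_op a b \<circ> pairs_op qs"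
    and "pairs_prod rs = a \<otimes> pairs_prod qs \<otimes> b"
  using assms(3) unfolding rs_def
proof (induction qs)
  case Nil
  { case 1 show ?case by simp next
    case 2 show ?case by (simp add: fun_eq_iff operator_simps(3)[OF elem_op_linear] assms) next
    case 3 show ?case by (simp add: assms) }
next
  case (Cons q qs)
  obtain c d where q: "q = (c, d)" by force
  { case 1 then show ?case using Cons.IH(1) assms(1,2) by (auto simp: q) next
    case 2 then show ?case
      using Cons.IH(2) assms(1,2)
      by (simp add: q fun_eq_iff operator_simps[OF elem_op_linear] flip: elem_op_comp) next
    case 3 then show ?case
      using Cons.IH(3) assms(1,2) by (simp add: q A.r_distr A.l_distr A.m_assoc) }
qed

text \<open>The product has terms a c d b, and summing over \<open>qs\<close> first puts
  \<open>pairs_prod qs\<close> in the middle. In the reverse order the terms are d b a c, and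
  summing over \<open>ps\<close> first brings out \<open>pairs_rev_prod ps\<close>. Thus the two
  conditions come from different factors.\<close>

lemma tensor_mult_props:
  assumes "set ps \<subseteq> carrier B \<times> carrier B" "set qs \<subseteq> carrier B \<times> carrier B"
  shows "set (tensor_mult ps qs) \<subseteq> carrier B \<times> carrier B"
    and "pairs_op (tensor_mult ps qs) = pairs_op ps \<circ> pairs_op qs"
    and "pairs_prod qs = \<zero> \<Longrightarrow> pairs_prod (tensor_mult ps qs) = \<zero>"
    and "pairs_rev_prod ps = \<zero> \<Longrightarrow> pairs_rev_prod (tensor_mult ps qs) = \<zero>"
proof -
  have "set (tensor_mult ps qs) \<subseteq> carrier B \<times> carrier B \<and>
    pairs_op (tensor_mult ps qs) = pairs_op ps \<circ> pairs_op qs \<and>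
    (pairs_prod qs = \<zero> \<longrightarrow> pairs_prod (tensor_mult ps qs) = \<zero>)"
    using assms(1)
  proof (induction ps)
    case Nil
    then show ?case by (simp add: fun_eq_iff)
  next
    case (Cons p ps)
    obtain a b where p: "p = (a, b)" by force
    have ab: "a \<in> carrier B" "b \<in> carrier B" and IH: "set (tensor_mult ps qs) \<subseteq> carrier B \<times> carrier B"
      "pairs_op (tensor_mult ps qs) = pairs_op ps \<circ> pairs_op qs"
      "pairs_prod qs = \<zero> \<Longrightarrow> pairs_prod (tensor_mult ps qs) = \<zero>"
      using Cons by (auto simp: p)
    note m = map_tensor[OF ab assms(2)]
    have "set (tensor_mult (p # ps) qs) \<subseteq> carrier B \<times> carrier B"
      using IH(1) m(1) unfolding p tensor_mult_simps set_append by simp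
    moreover have "pairs_op (tensor_mult (p # ps) qs) = pairs_op (p # ps) \<circ> pairs_op qs"
      unfolding p tensor_mult_simps pairs_append(1)[OF m(1) IH(1)] m(2) IH(2)
      by (simp add: fun_eq_iff)
    moreover have "pairs_prod (tensor_mult (p # ps) qs) = \<zero>" if "pairs_prod qs = \<zero>"
      unfolding p tensor_mult_simps pairs_append(2)[OF m(1) IH(1)] m(3) IH(3)[OF that] that
      using ab by simp
    ultimately show ?case by blast
  qed
  then show "set (tensor_mult ps qs) \<subseteq> carrier B \<times> carrier B"
    "pairs_op (tensor_mult ps qs) = pairs_op ps \<circ> pairs_op qs"
    "pairs_prod qs = \<zero> \<Longrightarrow> pairs_prod (tensor_mult ps qs) = \<zero>"
    by auto
  \<comment> \<open>The reverse product of the composite depends on \<open>ps\<close> only through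
    its own reverse product, by way of the additive map \<open>G\<close>.\<close>
  define G where "G s = list_sum (map (\<lambda>(c, d). d \<otimes> s \<otimes> c) qs)" for s
  have G_closed: "G s \<in> carrier B" if "s \<in> carrier B" for s
    using that assms(2) unfolding G_def by (intro list_sum_closed) auto
  have G_add: "G (s \<oplus> s') = G s \<oplus> G s'" if ss: "s \<in> carrier B" "s' \<in> carrier B" for s s'
    using assms(2) unfolding G_def
  proof (induction qs)
    case (Cons q qs)
    obtain c d where q: "q = (c, d)" by force
    have "list_sum (map (\<lambda>(c, d). d \<otimes> s \<otimes> c) qs) \<in> carrier B"
      "list_sum (map (\<lambda>(c, d). d \<otimes> s' \<otimes> c) qs) \<in> carrier B"
      using Cons.prems ss by (intro list_sum_closed; fastforce)+
    then show ?case
      using Cons ss by (simp add: q A.r_distr A.l_distr A.a_ac)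
  qed simp
  have G_zero: "G \<zero> = \<zero>"
    using assms(2) unfolding G_def by (induction qs) auto
  have G_single: "pairs_rev_prod (map (\<lambda>(c, d). (a \<otimes> c, d \<otimes> b)) qs) = G (b \<otimes> a)"
    if "a \<in> carrier B" "b \<in> carrier B" for a b
    using assms(2) that unfolding G_def by (induction qs) (auto simp: A.m_assoc)
  have "pairs_rev_prod (tensor_mult ps qs) = G (pairs_rev_prod ps)"
    using assms(1)
  proof (induction ps)
    case Nil
    then show ?case by (simp add: G_zero)
  next
    case (Cons p ps)
    obtain a b where p: "p = (a, b)" by force
    have ab: "a \<in> carrier B" "b \<in> carrier B" and ps: "set ps \<subseteq> carrier B \<times> carrier B"
      using Cons by (auto simp: p)
    have "set (tensor_mult ps qs) \<subseteq> carrier B \<times> carrier B"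
      using ps assms(2) unfolding tensor_mult_def by fastforce
    then show ?case
      unfolding p tensor_mult_simps
      using Cons.IH[OF ps] ab ps
      by (simp add: pairs_append(3)[OF map_tensor(1)[OF ab assms(2)]] G_single G_add)
  qed
  then show "pairs_rev_prod ps = \<zero> \<Longrightarrow> pairs_rev_prod (tensor_mult ps qs) = \<zero>"
    by (simp add: G_zero)
qed

abbreviation "M \<equiv> M_Lie B lact ract"

lemma pairs_upt:
  fixes m :: nat
  assumes "a \<in> {1..m} \<rightarrow> carrier B" "b \<in> {1..m} \<rightarrow> carrier B"
  defines "ps \<equiv> map (\<lambda>k. (a k, b k)) [1..<Suc m]"
  shows "pairs_op ps = (\<lambda>x. \<Sum>k=1..m. lact (a k) (ract x (b k)))"
    and "pairs_prod ps = (\<Oplus>k\<in>{1..m}. a k \<otimes> b k)"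
    and "pairs_rev_prod ps = (\<Oplus>k\<in>{1..m}. b k \<otimes> a k)"
proof -
  have "pairs_op ps = (\<Sum>k\<in>{1..m}. elem_op (a k) (b k))"
    by (simp only: ps_def pairs_op_def map_map o_def prod.case interv_sum_list_conv_sum_set_nat
        set_upt atLeastLessThanSuc_atLeastAtMost)
  then show "pairs_op ps = (\<lambda>x. \<Sum>k=1..m. lact (a k) (ract x (b k)))"
    by (simp add: fun_eq_iff sum_fun_apply elem_op_def)
  have "(\<lambda>k. a k \<otimes> b k) \<in> {1..m} \<rightarrow> carrier B" "(\<lambda>k. b k \<otimes> a k) \<in> {1..m} \<rightarrow> carrier B"
    using assms(1,2) by auto
  from this[THEN list_sum_upt]
  show "pairs_prod ps = (\<Oplus>k\<in>{1..m}. a k \<otimes> b k)"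
    "pairs_rev_prod ps = (\<Oplus>k\<in>{1..m}. b k \<otimes> a k)"
    by (simp_all only: ps_def pairs_prod_def pairs_rev_prod_def map_map o_def prod.case)
qed

lemma M_Lie_eq:
  "M = {pairs_op ps | ps. set ps \<subseteq> carrier B \<times> carrier B \<and>
     pairs_prod ps = \<zero> \<and> pairs_rev_prod ps = \<zero>}" (is "_ = ?R")
proof (intro equalityI subsetI)
  fix T assume "T \<in> M"
  then obtain m :: nat and a b where T: "T = (\<lambda>x. \<Sum>k=1..m. lact (a k) (ract x (b k)))"
    and ab: "a \<in> {1..m} \<rightarrow> carrier B" "b \<in> {1..m} \<rightarrow> carrier B"
    and sums: "(\<Oplus>k\<in>{1..m}. a k \<otimes> b k) = \<zero>" "(\<Oplus>k\<in>{1..m}. b k \<otimes> a k) = \<zero>"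
    unfolding M_Lie_def by blast
  let ?ps = "map (\<lambda>k. (a k, b k)) [1..<Suc m]"
  have "set ?ps \<subseteq> carrier B \<times> carrier B"
    using ab by auto
  moreover have "pairs_op ?ps = T" "pairs_prod ?ps = \<zero>" "pairs_rev_prod ?ps = \<zero>"
    using pairs_upt[OF ab] sums T by simp_all
  ultimately show "T \<in> ?R"
    by blast
next
  fix T assume "T \<in> ?R"
  then obtain ps where ps: "set ps \<subseteq> carrier B \<times> carrier B" "pairs_prod ps = \<zero>"
    "pairs_rev_prod ps = \<zero>" "T = pairs_op ps" by blast
  \<comment> \<open>\<open>M_Lie\<close> counts terms from 1, lists from 0.\<close>
  define a where "a k = fst (ps ! (k - 1))" for k
  define b where "b k = snd (ps ! (k - 1))" for k
  have ps_eq: "map (\<lambda>k. (a k, b k)) [1..<Suc (length ps)] = ps"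
    by (rule nth_equalityI) (auto simp: a_def b_def simp del: upt_Suc)
  have "ps ! (k - 1) \<in> carrier B \<times> carrier B" if "k \<in> {1..length ps}" for k
    using that ps(1) by (metis atLeastAtMost_iff diff_less le_trans nat_less_le nth_mem subsetD
      zero_less_one less_le_trans diff_le_self Suc_le_eq One_nat_def Suc_pred)
  then have ab: "a \<in> {1..length ps} \<rightarrow> carrier B" "b \<in> {1..length ps} \<rightarrow> carrier B"
    by (auto simp: a_def b_def mem_Times_iff)
  show "T \<in> M"
    unfolding M_Lie_def
    by (intro CollectI exI[of _ "length ps"] exI[of _ a] exI[of _ b] conjI ab)
      (use pairs_upt[OF ab, unfolded ps_eq] ps in simp_all)
qed

lemma pairs_op_linear:
  "set ps \<subseteq> carrier B \<times> carrier B \<Longrightarrow> Vector_Spaces.linear scale scale (pairs_op ps)"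
proof (induction ps)
  case Nil
  then show ?case by (auto intro: operatorI)
next
  case (Cons p ps)
  obtain a b where p: "p = (a, b)" by force
  have "Vector_Spaces.linear scale scale (elem_op a b)" "Vector_Spaces.linear scale scale (pairs_op ps)"
    using Cons by (auto simp: p intro: elem_op_linear)
  then show ?case
    by (intro operatorI) (simp_all add: p operator_simps scale_right_distrib algebra_simps)
qed

lemma pairs_op_in_M:
  "\<lbrakk>set ps \<subseteq> carrier B \<times> carrier B; pairs_prod ps = \<zero>; pairs_rev_prod ps = \<zero>\<rbrakk> \<Longrightarrow> pairs_op ps \<in> M"
  unfolding M_Lie_eq by blast

lemma M_subalgebra: "subalgebra (operator_algebra scale) M"
proof -
  show ?thesis
    unfolding subalgebra_def
  proof (intro conjI ballI allI)
    show "M \<subseteq> carrier (operator_algebra scale)"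
      by (auto simp: M_Lie_eq operator_algebra_def pairs_op_linear)
    show "\<zero>\<^bsub>operator_algebra scale\<^esub> \<in> M"
      using pairs_op_in_M[of "[]"] by (simp add: operator_algebra_def zero_fun_def)
  next
    fix S T assume "S \<in> M" "T \<in> M"
    then obtain ps qs where ps: "set ps \<subseteq> carrier B \<times> carrier B" "pairs_prod ps = \<zero>"
        "pairs_rev_prod ps = \<zero>" "S = pairs_op ps"
      and qs: "set qs \<subseteq> carrier B \<times> carrier B" "pairs_prod qs = \<zero>"
        "pairs_rev_prod qs = \<zero>" "T = pairs_op qs"
      unfolding M_Lie_eq by blast
    show "S \<oplus>\<^bsub>operator_algebra scale\<^esub> T \<in> M"
      using pairs_op_in_M[of "ps @ qs"] ps qs
      by (simp add: pairs_append operator_algebra_def plus_fun_def)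
    show "S \<otimes>\<^bsub>operator_algebra scale\<^esub> T \<in> M"
      using pairs_op_in_M[of "tensor_mult ps qs"] ps qs
      by (simp add: tensor_mult_props operator_algebra_def)
  next
    fix c T assume "T \<in> M"
    then obtain ps where ps: "set ps \<subseteq> carrier B \<times> carrier B" "pairs_prod ps = \<zero>"
        "pairs_rev_prod ps = \<zero>" "T = pairs_op ps"
      unfolding M_Lie_eq by blast
    define qs where "qs = map (\<lambda>(a, b). (c \<odot> a, b)) ps"
    have "set qs \<subseteq> carrier B \<times> carrier B \<and> pairs_op qs = scale_op scale c (pairs_op ps) \<and>
      pairs_prod qs = c \<odot> pairs_prod ps \<and> pairs_rev_prod qs = c \<odot> pairs_rev_prod ps"
      using ps(1) unfolding qs_def
      by (induction ps) (auto simp: elem_op_scale_left ops.scale_right_distrib smult_mult_left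
        smult_mult_right scalar_add_right)
    then show "c \<odot>\<^bsub>operator_algebra scale\<^esub> T \<in> M"
      using pairs_op_in_M[of qs] ps by (simp add: operator_algebra_def scale_op_def)
  qed
qed

lemma D_subset_M: "D \<subseteq> M"
  unfolding D_Lie_def
proof (rule hull_minimal, rule image_subsetI)
  fix a assume a: "a \<in> carrier B"
  then show "\<delta> a \<in> M"
    \<comment> \<open>\<open>\<delta> a\<close> comes from the tensor a \<otimes> 1 - 1 \<otimes> a,
      both of whose products are a - a.\<close>
    using pairs_op_in_M[of "[(a, \<one>), (\<ominus> \<one>, a)]"]
    by (simp add: elem_op_minus_left A.l_minus A.r_minus A.r_neg inner_derivation_eq)
qed (rule M_subalgebra)

end

section \<open>Singly generated algebras\<close>

context unital_algebra
begin

text \<open>The polynomials in \<open>g\<close>, built one monomial at a time: the induction rule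
  replaces any choice of coefficients and reduces bilinear claims to pairs of powers.\<close>

inductive_set power_span :: "'a \<Rightarrow> 'a set" for g where
  zero: "\<zero> \<in> power_span g"
| step: "b \<in> power_span g \<Longrightarrow> c \<odot> (g [^] (i::nat)) \<oplus> b \<in> power_span g"

lemma power_span_closed: "b \<in> power_span g \<Longrightarrow> g \<in> carrier A \<Longrightarrow> b \<in> carrier A"
  by (induction rule: power_span.induct) auto

lemma power_span_add:
  assumes "b \<in> power_span g" "b' \<in> power_span g" "g \<in> carrier A"
  shows "b \<oplus> b' \<in> power_span g"
  using assms(1)
proof (induction rule: power_span.induct)
  case zero
  then show ?case using assms by (simp add: power_span_closed)
next
  case (step b c i)
  have "c \<odot> (g [^] i) \<oplus> (b \<oplus> b') \<in> power_span g"
    by (rule power_span.step) (rule step.IH)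
  then show ?case
    using step.hyps assms by (simp add: A.a_assoc power_span_closed)
qed

lemma power_span_scale:
  assumes "b \<in> power_span g" "g \<in> carrier A"
  shows "d \<odot> b \<in> power_span g"
  using assms(1)
proof (induction rule: power_span.induct)
  case zero
  then show ?case by (simp add: power_span.zero)
next
  case (step b c i)
  have "(d * c) \<odot> (g [^] i) \<oplus> d \<odot> b \<in> power_span g"
    by (rule power_span.step) (rule step.IH)
  then show ?case
    using step.hyps assms by (simp add: scalar_add_right scalar_scalar power_span_closed)
qed

lemma power_span_mult:
  assumes "b \<in> power_span g" "b' \<in> power_span g" "g \<in> carrier A"
  shows "b \<otimes> b' \<in> power_span g"
  using assms(1)
proof (induction rule: power_span.induct)
  case zero
  then show ?case using assms by (simp add: power_span_closed power_span.zero)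
next
  case (step b c i)
  have "g [^] i \<otimes> b' \<in> power_span g"
    using assms(2)
  proof (induction rule: power_span.induct)
    case zero
    then show ?case using assms by (simp add: power_span.zero)
  next
    case (step b c j)
    have "c \<odot> (g [^] (i + j)) \<oplus> (g [^] i \<otimes> b) \<in> power_span g"
      by (rule power_span.step) (rule step.IH)
    then show ?case
      using step.hyps assms by (simp add: A.r_distr smult_mult_right A.nat_pow_mult power_span_closed)
  qed
  then have "c \<odot> (g [^] i \<otimes> b') \<oplus> b \<otimes> b' \<in> power_span g"
    using assms step.IH by (intro power_span_add power_span_scale)
  then show ?case
    using step.hyps assms by (simp add: A.l_distr smult_mult_left power_span_closed)
qed

lemma power_span_power:
  assumes "g \<in> carrier A"
  shows "g [^] (i::nat) \<in> power_span g"
proof -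
  have "1 \<odot> (g [^] i) \<oplus> \<zero> \<in> power_span g"
    by (rule power_span.step) (rule power_span.zero)
  then show ?thesis using assms by simp
qed

end

context unital_bimodule
begin

lemma hull_subset_power_span:
  assumes g: "g \<in> carrier B"
  shows "subalgebra B hull {\<one>, g} \<subseteq> power_span g"
proof (rule hull_minimal)
  show "{\<one>, g} \<subseteq> power_span g"
    using power_span_power[OF g, of 0] power_span_power[OF g, of 1] g by simp
  show "subalgebra B (power_span g)"
    using g by (auto simp: subalgebra_def power_span.zero power_span_closed power_span_add
      power_span_scale power_span_mult)
qed

lemma M_subset_D_if_singly_generated:
  assumes "singly_generated B"
  shows "M \<subseteq> D"
proof -
  obtain g where g: "g \<in> carrier B" and gen: "subalgebra B hull {\<one>, g} = carrier B"
    using assms by (auto simp: singly_generated_def)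
  have span: "carrier B \<subseteq> power_span g"
    using hull_subset_power_span[OF g] gen by simp
  define t where "t i j = elem_op (g [^] i) (g [^] j)" for i j :: nat
  define d where "d i j = t (Suc i) j - t i (Suc j)" for i j :: nat
  \<comment> \<open>Stated for a difference of two \<open>t\<close>, so that it turns a
    \<open>d\<close> into a difference of neighbouring \<open>d\<close>.\<close>
  have g_comp: "\<delta> g \<circ> (t i j - t k l) = t (Suc i) j - t i (Suc j) - (t (Suc k) l - t k (Suc l))" for i j k l
  proof -
    have "elem_op g \<one> \<circ> t i j = t (Suc i) j" "elem_op \<one> g \<circ> t i j = t i (Suc j)" for i j :: nat
      using g unfolding t_def
      by (simp_all add: elem_op_comp) (simp flip: A.nat_pow_Suc2)
    note * = this[THEN fun_cong, unfolded o_apply]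
    show ?thesis
      using g
      by (simp add: fun_eq_iff inner_derivation_eq operator_simps[OF elem_op_linear]
          * operator_diff[OF elem_op_linear])
  qed
  have d_in_D: "d i j \<in> D" if "i + j = n" for n i j
    using that
  proof (induction n arbitrary: i j)
    case 0
    moreover have "d 0 0 = \<delta> g"
      using g by (simp add: d_def t_def inner_derivation_eq)
    ultimately show ?case
      using inner_derivation_in_D[OF g] by simp
  next
    case (Suc n)
    \<comment> \<open>Neighbours with index sum n + 1 differ by \<open>\<delta> g\<close> composed
      with a \<open>d\<close> of index sum n. Hence modulo \<open>D\<close> all of them agree with
      \<open>d 0 (Suc n)\<close>.\<close>
    have step: "d (Suc i) j - d i (Suc j) \<in> D" if "i + j = n" for i j :: nat
      using D_comp[OF inner_derivation_in_D[OF g] Suc.IH[OF that]]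
      by (simp only: d_def g_comp)
    have shift: "d i (Suc n - i) - d 0 (Suc n) \<in> D" if "i \<le> Suc n" for i :: nat
      using that
    proof (induction i)
      case (Suc i)
      have "d (Suc i) (n - i) - d i (Suc (n - i)) + (d i (Suc n - i) - d 0 (Suc n)) \<in> D"
      proof (rule D_add)
        show "d (Suc i) (n - i) - d i (Suc (n - i)) \<in> D"
          using Suc.prems by (intro step) simp
        show "d i (Suc n - i) - d 0 (Suc n) \<in> D"
          by (rule Suc.IH) (use Suc.prems in simp)
      qed
      also have "d (Suc i) (n - i) - d i (Suc (n - i)) + (d i (Suc n - i) - d 0 (Suc n)) =
          d (Suc i) (Suc n - Suc i) - d 0 (Suc n)"
        using Suc.prems by (simp add: Suc_diff_le fun_eq_iff)
      finally show ?case .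
    qed (simp add: D_zero)
    \<comment> \<open>Over the whole antidiagonal the sum telescopes to the difference of its two
      ends, which is the inner derivation of a power of \<open>g\<close>.\<close>
    have "(\<Sum>i\<le>k. d i (Suc n - i)) = t (Suc k) (Suc n - k) - t 0 (Suc (Suc n))" if "k \<le> Suc n" for k :: nat
      using that
    proof (induction k)
      case (Suc k)
      then have "Suc (Suc n - Suc k) = Suc n - k"
        by simp
      then show ?case
        using Suc by (simp add: d_def del: diff_Suc_Suc)
    qed (simp add: d_def)
    from this[of "Suc n"] have "(\<Sum>i\<le>Suc n. d i (Suc n - i)) = \<delta> (g [^] Suc (Suc n))"
      using g by (simp add: t_def inner_derivation_eq)
    then have "(\<Sum>i\<le>Suc n. d i (Suc n - i)) \<in> D"
      using g by (simp only: inner_derivation_in_D A.nat_pow_closed)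
    moreover have "(\<Sum>i\<le>Suc n. d i (Suc n - i) - d 0 (Suc n)) \<in> D"
      by (rule D_sum) (use shift in auto)
    ultimately have "(\<Sum>i\<le>Suc n. d 0 (Suc n)) \<in> D"
      by (simp only: sum_subtractf D_diff_cong)
    \<comment> \<open>There are n + 2 equal summands, and this factor can be divided out over the
      complex numbers.\<close>
    also have "(\<Sum>i\<le>Suc n. d 0 (Suc n)) = scale_op scale (of_nat (n + 2)) (d 0 (Suc n))"
      by (subst ops.scale_sum_left[symmetric, of "\<lambda>_. 1", simplified]) simp
    finally have "d 0 (Suc n) \<in> D"
      by (rule D_scale_cancel) (metis of_nat_eq_0_iff add_2_eq_Suc' nat.distinct(1))
    moreover have "d i j - d 0 (Suc n) \<in> D"
      using shift[of i] Suc.prems by (metis add_diff_cancel_left' le_add1)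
    ultimately show ?case
      using D_diff_cong by blast
  qed
  have t_in_D: "t i j - t 0 (i + j) \<in> D" for i j :: nat
  proof (induction i arbitrary: j)
    case (Suc i)
    have "d i j + (t i (Suc j) - t 0 (i + Suc j)) \<in> D"
      by (intro D_add Suc.IH d_in_D[OF refl])
    also have "d i j + (t i (Suc j) - t 0 (i + Suc j)) = t (Suc i) j - t 0 (Suc i + j)"
      by (simp add: d_def fun_eq_iff)
    finally show ?case .
  qed (simp add: D_zero)
  \<comment> \<open>\<open>h\<close> is bilinear, so it takes values in \<open>D\<close> on
    polynomials in \<open>g\<close> once it does so on pairs of powers, where it equals
    \<open>t i j - t 0 (i + j)\<close>.\<close>
  define h where "h a b = elem_op a b - elem_op \<one> (a \<otimes> b)" for a b
  have h_zero: "h \<zero> b = 0" "h b \<zero> = 0" if "b \<in> carrier B" for b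
    using that by (simp_all add: h_def)
  have h_left: "h (c \<odot> a \<oplus> a') b = scale_op scale c (h a b) + h a' b"
    and h_right: "h b (c \<odot> a \<oplus> a') = scale_op scale c (h b a) + h b a'"
    if "a \<in> carrier B" "a' \<in> carrier B" "b \<in> carrier B" for a a' b c
    using that by (simp_all add: h_def elem_op_add_left elem_op_add_right elem_op_scale_left
      elem_op_scale_right A.l_distr A.r_distr smult_mult_left smult_mult_right
      ops.scale_right_diff_distrib fun_eq_iff)
  have h_power: "h (g [^] i) (g [^] j) \<in> D" for i j :: nat
    using t_in_D[of i j] g by (simp add: h_def t_def A.nat_pow_mult)
  have key: "h a b \<in> D" if a: "a \<in> power_span g" and b: "b \<in> power_span g" for a b
    using a
  proof (induction rule: power_span.induct)
    case zero
    then show ?case using power_span_closed[OF b g] by (simp only: h_zero D_zero)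
  next
    case (step a c i)
    have "h (g [^] i) b \<in> D"
      using b
    proof (induction rule: power_span.induct)
      case zero
      then show ?case using g by (simp only: h_zero D_zero A.nat_pow_closed)
    next
      case (step b c j)
      then show ?case
        using power_span_closed[OF step.hyps g] g
        by (simp only: h_right A.nat_pow_closed D_add D_scale h_power)
    qed
    then show ?case
      using power_span_closed[OF step.hyps g] power_span_closed[OF b g] g step.IH
      by (simp only: h_left A.nat_pow_closed D_add D_scale)
  qed
  have "pairs_op ps - elem_op \<one> (pairs_prod ps) \<in> D" if "set ps \<subseteq> carrier B \<times> carrier B" for ps
    using that
  proof (induction ps)
    case Nil
    have "pairs_op [] - elem_op \<one> (pairs_prod []) = 0" by simp
    then show ?case by (simp only: D_zero)
  next
    case (Cons p ps)
    obtain a b where p: "p = (a, b)" by force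
    have ab: "a \<in> carrier B" "b \<in> carrier B" and ps: "set ps \<subseteq> carrier B \<times> carrier B"
      using Cons.prems by (auto simp: p)
    have "h a b + (pairs_op ps - elem_op \<one> (pairs_prod ps)) \<in> D"
      using ab span by (intro D_add key Cons.IH ps) auto
    also have "h a b + (pairs_op ps - elem_op \<one> (pairs_prod ps)) =
        pairs_op (p # ps) - elem_op \<one> (pairs_prod (p # ps))"
      using ab ps by (simp add: p h_def elem_op_add_right fun_eq_iff)
    finally show ?case .
  qed
  then show ?thesis
    by (force simp: M_Lie_eq)
qed

end

section \<open>Minimal idempotents\<close>

text \<open>By \<open>minimal\<close> the corner p A p consists of multiples of \<open>p\<close>,
  which gives a scalar pairing of p A with A p; \<open>prime\<close> makes this pairing
  nondegenerate on both sides, as \<open>row_dual\<close> and \<open>col_dual\<close> show.\<close>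

locale minimal_idempotent = unital_algebra +
  fixes p
  assumes p_closed [simp, intro]: "p \<in> carrier A"
    and p_nonzero: "p \<noteq> \<zero>"
    and p_idem [simp]: "p \<otimes> p = p"
    and minimal: "a \<in> carrier A \<Longrightarrow> \<exists>c. p \<otimes> a \<otimes> p = c \<odot> p"
    and prime: "a \<in> carrier A \<Longrightarrow> a \<noteq> \<zero> \<Longrightarrow>
      \<exists>h\<in>carrier A. \<exists>z\<in>carrier A. p \<otimes> h \<otimes> a \<otimes> z \<otimes> p \<noteq> \<zero>"
begin

text \<open>Column vectors; \<open>pA\<close> below holds the row vectors. When \<open>p\<close> is
  the first diagonal matrix unit, these are the matrices supported in the first column and in the
  first row, and x \<otimes> f has rank at most one.\<close>

definition Ap where "Ap = {x \<in> carrier A. x \<otimes> p = x}"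

definition pA where "pA = {f \<in> carrier A. p \<otimes> f = f}"

lemma Ap_intros [simp, intro]:
  "p \<in> Ap" "\<zero> \<in> Ap"
  "x \<in> Ap \<Longrightarrow> y \<in> Ap \<Longrightarrow> x \<oplus> y \<in> Ap"
  "x \<in> Ap \<Longrightarrow> c \<odot> x \<in> Ap"
  "x \<in> Ap \<Longrightarrow> a \<in> carrier A \<Longrightarrow> a \<otimes> x \<in> Ap"
  "a \<in> carrier A \<Longrightarrow> a \<otimes> p \<in> Ap"
  by (auto simp: Ap_def A.l_distr smult_mult_left A.m_assoc)

lemma pA_intros [simp, intro]:
  "p \<in> pA" "\<zero> \<in> pA"
  "f \<in> pA \<Longrightarrow> g \<in> pA \<Longrightarrow> f \<oplus> g \<in> pA"
  "f \<in> pA \<Longrightarrow> c \<odot> f \<in> pA"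
  "f \<in> pA \<Longrightarrow> a \<in> carrier A \<Longrightarrow> f \<otimes> a \<in> pA"
  "a \<in> carrier A \<Longrightarrow> p \<otimes> a \<in> pA"
  by (auto simp: pA_def A.r_distr smult_mult_right simp flip: A.m_assoc)

lemma Ap_closed [simp, intro]: "x \<in> Ap \<Longrightarrow> x \<in> carrier A"
  and pA_closed [simp, intro]: "f \<in> pA \<Longrightarrow> f \<in> carrier A"
  and Ap_p [simp]: "x \<in> Ap \<Longrightarrow> x \<otimes> p = x"
  and pA_p [simp]: "f \<in> pA \<Longrightarrow> p \<otimes> f = f"
  by (simp_all add: Ap_def pA_def)

text \<open>The pairing of rows with columns, in matrix terms the trace of x \<otimes> f. The
  coefficient is unique because \<open>p\<close> is nonzero, and it exists for \<open>f\<close> in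
  \<open>pA\<close> and \<open>x\<close> in \<open>Ap\<close> by \<open>mult_eq_br\<close>.\<close>

definition br where "br f x = (THE c. f \<otimes> x = c \<odot> p)"

lemma br_unique: "f \<otimes> x = c \<odot> p \<Longrightarrow> br f x = c"
  unfolding br_def using scalar_cancel[OF p_closed p_nonzero] by (intro the_equality) auto

lemma mult_eq_br:
  assumes "f \<in> pA" "x \<in> Ap"
  shows "f \<otimes> x = br f x \<odot> p"
proof -
  obtain c where "p \<otimes> (f \<otimes> x) \<otimes> p = c \<odot> p"
    using minimal[of "f \<otimes> x"] assms by auto
  moreover have "p \<otimes> (f \<otimes> x) \<otimes> p = f \<otimes> x"
    using assms by (metis A.m_assoc Ap_closed Ap_p p_closed pA_closed pA_p A.m_closed)
  ultimately show ?thesis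
    using br_unique by simp
qed

lemma br_simps:
  assumes "f \<in> pA" "x \<in> Ap"
  shows "g \<in> pA \<Longrightarrow> br (f \<oplus> g) x = br f x + br g x"
    and "y \<in> Ap \<Longrightarrow> br f (x \<oplus> y) = br f x + br f y"
    and "br (c \<odot> f) x = c * br f x"
    and "br f (c \<odot> x) = c * br f x"
proof -
  show "br (f \<oplus> g) x = br f x + br g x" if "g \<in> pA"
    using assms that by (intro br_unique) (simp add: A.l_distr scalar_add_left flip: mult_eq_br)
  show "br f (x \<oplus> y) = br f x + br f y" if "y \<in> Ap"
    using assms that by (intro br_unique) (simp add: A.r_distr scalar_add_left flip: mult_eq_br)
  show "br (c \<odot> f) x = c * br f x" "br f (c \<odot> x) = c * br f x"
    using assms by (auto intro!: br_unique simp: smult_mult_left smult_mult_right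
      simp flip: mult_eq_br scalar_scalar)
qed

lemma br_p [simp]: "br p p = 1"
  by (rule br_unique) simp

lemma col_br:
  assumes "f \<in> pA" "x \<in> Ap" "y \<in> Ap"
  shows "y \<otimes> (f \<otimes> x) = br f x \<odot> y"
  using assms by (simp add: mult_eq_br smult_mult_right)

lemma br_row:
  assumes "f \<in> pA" "x \<in> Ap" "g \<in> pA"
  shows "f \<otimes> (x \<otimes> g) = br f x \<odot> g"
  using assms by (simp add: mult_eq_br smult_mult_left flip: A.m_assoc)

lemma row_dual:
  assumes f: "f \<in> pA" "f \<noteq> \<zero>"
  obtains z where "z \<in> Ap" "f \<otimes> z = p"
proof -
  obtain h z where hz: "h \<in> carrier A" "z \<in> carrier A" "p \<otimes> h \<otimes> f \<otimes> z \<otimes> p \<noteq> \<zero>"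
    using prime[of f] f by auto
  have "p \<otimes> h \<otimes> f \<otimes> z \<otimes> p = p \<otimes> h \<otimes> (f \<otimes> (z \<otimes> p))"
    using f hz by (simp add: A.m_assoc)
  then have "br f (z \<otimes> p) \<noteq> 0"
    using hz f mult_eq_br[of f "z \<otimes> p"] by auto
  moreover from this have "f \<otimes> (inverse (br f (z \<otimes> p)) \<odot> (z \<otimes> p)) = p"
    using hz f by (simp add: mult_eq_br br_simps)
  ultimately show ?thesis
    using that hz by blast
qed

lemma col_dual:
  assumes x: "x \<in> Ap" "x \<noteq> \<zero>"
  obtains h where "h \<in> pA" "h \<otimes> x = p"
proof -
  obtain h z where hz: "h \<in> carrier A" "z \<in> carrier A" "p \<otimes> h \<otimes> x \<otimes> z \<otimes> p \<noteq> \<zero>"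
    using prime[of x] x by auto
  have "p \<otimes> h \<otimes> x \<otimes> z \<otimes> p = (p \<otimes> h \<otimes> x) \<otimes> (z \<otimes> p)"
    using x hz by (simp add: A.m_assoc)
  then have "br (p \<otimes> h) x \<noteq> 0"
    using hz x mult_eq_br[of "p \<otimes> h" x] by auto
  moreover from this have "(inverse (br (p \<otimes> h) x) \<odot> (p \<otimes> h)) \<otimes> x = p"
    using hz x by (simp add: mult_eq_br br_simps)
  ultimately show ?thesis
    using that hz by blast
qed

text \<open>This is the case of dimension one. The column x - p x is annihilated by
  \<open>p\<close>, so it vanishes and x = p x is a multiple of \<open>p\<close>; rows are treated
  in the same way.\<close>

lemma multiples_of_p:
  assumes "\<And>x f. x \<in> Ap \<Longrightarrow> f \<in> pA \<Longrightarrow> f \<otimes> x = \<zero> \<Longrightarrow> x = \<zero> \<or> f = \<zero>"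
  shows "x \<in> Ap \<Longrightarrow> \<exists>c. x = c \<odot> p" "f \<in> pA \<Longrightarrow> \<exists>c. f = c \<odot> p"
proof -
  have eqI: "a = b" if "b \<oplus> (- 1) \<odot> a = \<zero>" "a \<in> carrier A" "b \<in> carrier A" for a b
    using that by (metis A.add.inv_closed A.minus_equality A.minus_minus scalar_minus_one)
  show "\<exists>c. x = c \<odot> p" if x: "x \<in> Ap"
  proof -
    have "p \<otimes> (x \<oplus> (- 1) \<odot> (p \<otimes> x)) = \<zero>"
      using x by (simp add: A.r_distr smult_mult_right flip: A.m_assoc) (simp add: scalar_minus_one A.r_neg)
    then have "x \<oplus> (- 1) \<odot> (p \<otimes> x) = \<zero>"
      using assms[of "x \<oplus> (- 1) \<odot> (p \<otimes> x)" p] x p_nonzero by auto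
    then have "p \<otimes> x = x"
      by (rule eqI) (use x in simp_all)
    then show ?thesis
      using mult_eq_br[OF pA_intros(1) x] by metis
  qed
  show "\<exists>c. f = c \<odot> p" if f: "f \<in> pA"
  proof -
    have "(f \<oplus> (- 1) \<odot> (f \<otimes> p)) \<otimes> p = \<zero>"
      using f by (simp add: A.l_distr smult_mult_left A.m_assoc) (simp add: scalar_minus_one A.r_neg)
    then have "f \<oplus> (- 1) \<odot> (f \<otimes> p) = \<zero>"
      using assms[of p "f \<oplus> (- 1) \<odot> (f \<otimes> p)"] f p_nonzero by auto
    then have "f \<otimes> p = f"
      by (rule eqI) (use f in simp_all)
    then show ?thesis
      using mult_eq_br[OF f Ap_intros(1)] by metis
  qed
qed

text \<open>
  Read \<open>w x f\<close> as the image of the rank one element \<open>x \<otimes> f\<close> under a linear map that intertwines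
  \<open>ad a\<close> with \<open>\<Delta> a\<close>; then \<open>br f x\<close> is the trace.  A nilpotent rank one element generates all
  elements of trace zero under the adjoint action: this is the representation theory of the copy
  of \<open>sl\<^sub>2\<close> spanned by \<open>x0 \<otimes> f0\<close>, \<open>z \<otimes> h\<close> and their commutator.
\<close>

lemma adjoint_generation:
  fixes sc :: "complex \<Rightarrow> 'o \<Rightarrow> 'o::ab_group_add" and S :: "'o set" and w :: "'a \<Rightarrow> 'a \<Rightarrow> 'o"
  assumes sc: "vector_space sc" and S: "module.subspace sc S"
    and scale_left: "\<And>x f c. x \<in> Ap \<Longrightarrow> f \<in> pA \<Longrightarrow> w (c \<odot> x) f = sc c (w x f)"
    and scale_right: "\<And>x f c. x \<in> Ap \<Longrightarrow> f \<in> pA \<Longrightarrow> w x (c \<odot> f) = sc c (w x f)"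
    and \<Delta>_diff: "\<And>a u v. a \<in> carrier A \<Longrightarrow> \<Delta> a (u - v) = \<Delta> a u - \<Delta> a v"
    and \<Delta>_scale: "\<And>a c u. a \<in> carrier A \<Longrightarrow> \<Delta> a (sc c u) = sc c (\<Delta> a u)"
    and \<Delta>_S: "\<And>a u. a \<in> carrier A \<Longrightarrow> u \<in> S \<Longrightarrow> \<Delta> a u \<in> S"
    and \<Delta>_w: "\<And>a x f. a \<in> carrier A \<Longrightarrow> x \<in> Ap \<Longrightarrow> f \<in> pA \<Longrightarrow>
      \<Delta> a (w x f) = w (a \<otimes> x) f - w x (f \<otimes> a)"
    and x0: "x0 \<in> Ap" "x0 \<noteq> \<zero>" and f0: "f0 \<in> pA" "f0 \<noteq> \<zero>"
    and nilpotent: "f0 \<otimes> x0 = \<zero>" and start: "w x0 f0 \<in> S"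
    and x: "x \<in> Ap" and f: "f \<in> pA"
  shows "w x f - sc (br f x) (w p p) \<in> S"
proof -
  interpret O: vector_space sc by fact
  note sub = O.subspace_add[OF S] O.subspace_diff[OF S] O.subspace_scale[OF S]
  obtain h where h: "h \<in> pA" "h \<otimes> x0 = p"
    using col_dual[OF x0] by blast
  obtain z' where z': "z' \<in> Ap" "f0 \<otimes> z' = p"
    using row_dual[OF f0] by blast
  \<comment> \<open>The shift by a multiple of x0 keeps f0 z = p, because f0 x0 = 0, and makes z
    orthogonal to h. Now the columns x0, z are dual to the rows h, f0.\<close>
  define z where "z = z' \<oplus> (- br h z') \<odot> x0"
  have z: "z \<in> Ap" "br f0 z = 1" "br h z = 0"
    using z' h x0 f0 nilpotent br_unique[of f0 x0 0] br_unique[of f0 z' 1] br_unique[of h x0 1]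
    by (auto simp: z_def br_simps)
  have hx0: "br h x0 = 1"
    using h by (intro br_unique) simp
  \<comment> \<open>Acting with \<open>x \<otimes> h\<close> on \<open>w x0 f0\<close> replaces the
    column x0 by x, at the price of a multiple of \<open>w x0 h\<close>.\<close>
  have step1: "w x f0 - sc (br f0 x) (w x0 h) \<in> S" if "x \<in> Ap" for x
    using \<Delta>_S[OF _ start, of "x \<otimes> h"] that h x0 f0 hx0
    by (simp add: \<Delta>_w A.m_assoc col_br br_row scale_right)
  have w_zero: "w x0 \<zero> = 0"
    using scale_right[OF x0(1) f0(1), of 0] f0 by simp
  \<comment> \<open>Acting with \<open>z \<otimes> f\<close> then brings in the row f, because f0 z
    = p; the term containing h z is zero by the choice of z.\<close>
  have step2: "sc (br f x) (w z f0) - w x f - sc (br f0 x * br f x0) (w z h) \<in> S"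
    if "x \<in> Ap" "f \<in> pA" for x f
    using \<Delta>_S[OF _ step1[OF that(1)], of "z \<otimes> f"] that h x0 f0 z
    by (simp add: \<Delta>_w \<Delta>_diff \<Delta>_scale A.m_assoc col_br br_row scale_right scale_left w_zero)
  have "w z h + w z h \<in> S"
    using O.subspace_neg[OF S step2[OF z(1) h(1)]] z hx0 by simp
  then have "sc (1/2) (w z h + w z h) \<in> S"
    by (rule sub(3))
  moreover have "sc (1/2) (w z h + w z h) = sc (1/2 + 1/2) (w z h)"
    by (simp only: O.scale_left_distrib O.scale_right_distrib)
  ultimately have zh: "w z h \<in> S"
    by simp
  have step3: "w x f - sc (br f x) (w z f0) \<in> S" if "x \<in> Ap" "f \<in> pA" for x f
  proof -
    have "sc (br f x) (w z f0) - w x f \<in> S"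
      using sub(1)[OF step2[OF that] sub(3)[OF zh, of "br f0 x * br f x0"]] by simp
    then show ?thesis
      using O.subspace_neg[OF S] by fastforce
  qed
  \<comment> \<open>Comparison with x = f = p exchanges the reference element \<open>w z f0\<close>
    for \<open>w p p\<close>.\<close>
  have "(w x f - sc (br f x) (w z f0)) - sc (br f x) (w p p - sc (br p p) (w z f0)) \<in> S"
    by (rule sub(2)[OF step3[OF x f] sub(3)[OF step3[OF Ap_intros(1) pA_intros(1)]]])
  then show ?thesis
    by (simp add: O.scale_right_diff_distrib)
qed

end

section \<open>Elementary operators built from rank one elements\<close>

context unital_bimodule
begin

lemma inner_derivation_comp:
  "\<lbrakk>a \<in> carrier B; c \<in> carrier B; d \<in> carrier B\<rbrakk>
    \<Longrightarrow> \<delta> a \<circ> elem_op c d = elem_op (a \<otimes> c) d - elem_op c (d \<otimes> a)"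
  by (simp add: fun_eq_iff inner_derivation_eq elem_op_comp[THEN fun_cong, unfolded o_apply])

lemma comp_inner_derivation:
  "\<lbrakk>a \<in> carrier B; c \<in> carrier B; d \<in> carrier B\<rbrakk>
    \<Longrightarrow> elem_op c d \<circ> \<delta> a = elem_op (c \<otimes> a) d - elem_op c (a \<otimes> d)"
  by (simp add: fun_eq_iff inner_derivation_eq operator_diff[OF elem_op_linear]
      elem_op_comp[THEN fun_cong, unfolded o_apply])

lemma square_inner_derivation:
  "a \<in> carrier B \<Longrightarrow> \<delta> a \<circ> \<delta> a =
    elem_op (a \<otimes> a) \<one> + elem_op \<one> (a \<otimes> a) - scale_op scale 2 (elem_op a a)"
  using inner_derivation_comp[of a a \<one>] inner_derivation_comp[of a \<one> a]
    operator_diff[OF inner_derivation_linear[of a]] scale_left_distrib[of 1 1]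
  by (simp add: inner_derivation_eq[of a] fun_eq_iff scale_op_def)

lemma elem_op_finsum_left:
  assumes "finite I" "f \<in> I \<rightarrow> carrier B" "b \<in> carrier B"
  shows "elem_op (\<Oplus>i\<in>I. f i) b = (\<Sum>i\<in>I. elem_op (f i) b)"
  using assms(1,2)
  by (induction I) (simp_all add: assms(3) elem_op_add_left)

lemma elem_op_finsum_right:
  assumes "finite I" "f \<in> I \<rightarrow> carrier B" "b \<in> carrier B"
  shows "elem_op b (\<Oplus>i\<in>I. f i) = (\<Sum>i\<in>I. elem_op b (f i))"
  using assms(1,2)
  by (induction I) (simp_all add: assms(3) elem_op_add_right)

end

locale bimodule_minimal_idempotent =
  unital_bimodule B scale lact ract + minimal_idempotent B p
  for B :: "(complex, 'b) module" (structure)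
    and scale :: "complex \<Rightarrow> 'v::ab_group_add \<Rightarrow> 'v"
    and lact ract p
begin

abbreviation "sc \<equiv> scale_op scale"

text \<open>
  For \<open>u = y \<otimes> g\<close> and \<open>v = x \<otimes> f\<close>, the operator \<open>elem_op (x \<otimes> g) (y \<otimes> f)\<close> is \<open>v\<close> times the
  functional \<open>tr (u \<cdot>)\<close> when the bimodule is a matrix algebra.  Below, \<open>u\<close> and \<open>v\<close> are replaced
  by \<open>u - tr u p\<close> and \<open>v - tr v p\<close>.
\<close>

definition traceless_op :: "'b \<Rightarrow> 'b \<Rightarrow> 'b \<Rightarrow> 'b \<Rightarrow> 'v \<Rightarrow> 'v" where
  "traceless_op x g y f = elem_op (x \<otimes> g) (y \<otimes> f) - sc (br f x) (elem_op g y)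
     - sc (br g y) (elem_op x f - sc (br f x) (elem_op p p))"

text \<open>If a nonzero row annihilates a nonzero column, their rank one product n squares to zero,
  [n,n] lies in \<open>D\<close>, and \<open>adjoint_generation\<close> is applied twice: first for
  x and f, then for y and g. Otherwise all rows and columns are multiples of \<open>p\<close> and
  the operator is zero.\<close>

lemma traceless_op_in_D:
  assumes "x \<in> Ap" "y \<in> Ap" "f \<in> pA" "g \<in> pA"
  shows "traceless_op x g y f \<in> D"
proof (cases "\<exists>x0\<in>Ap. \<exists>f0\<in>pA. f0 \<otimes> x0 = \<zero> \<and> x0 \<noteq> \<zero> \<and> f0 \<noteq> \<zero>")
  case True
  then obtain x0 f0 where x0: "x0 \<in> Ap" "x0 \<noteq> \<zero>" and f0: "f0 \<in> pA" "f0 \<noteq> \<zero>" and nil: "f0 \<otimes> x0 = \<zero>"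
    by blast
  define n where "n = x0 \<otimes> f0"
  have n: "n \<in> carrier B" "n \<otimes> n = \<zero>"
  proof -
    show "n \<in> carrier B" using x0 f0 by (simp add: n_def)
    have "n \<otimes> n = x0 \<otimes> (f0 \<otimes> x0) \<otimes> f0" using x0 f0 by (simp add: n_def A.m_assoc)
    then show "n \<otimes> n = \<zero>" using x0 f0 nil by simp
  qed
  have "\<delta> n \<circ> \<delta> n = sc (- 2) (elem_op n n)"
    using n by (simp add: square_inner_derivation)
  then have nn: "elem_op n n \<in> D"
    using D_comp[OF inner_derivation_in_D inner_derivation_in_D] n D_scale_cancel[of "- 2"] by force
  \<comment> \<open>Composition with \<open>\<delta> a\<close> on the left acts on the outer factors
    x and f, as the adjoint action on x \<otimes> f, and leaves f0 and x0 in place.\<close>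
  have first: "elem_op (x \<otimes> f0) (x0 \<otimes> f) - sc (br f x) (elem_op (p \<otimes> f0) (x0 \<otimes> p)) \<in> D"
    by (rule adjoint_generation[where \<Delta> = "\<lambda>a T. \<delta> a \<circ> T" and w = "\<lambda>x f. elem_op (x \<otimes> f0) (x0 \<otimes> f)",
        OF ops.vector_space_axioms D_subspace _ _ _ _ _ _ x0 f0 nil _ assms(1,3)])
      (use x0 f0 nn in \<open>simp_all add: n_def smult_mult_left smult_mult_right elem_op_scale_left
        elem_op_scale_right fun_eq_iff operator_diff[OF inner_derivation_linear] scale_op_def
        operator_simps[OF inner_derivation_linear] D_comp inner_derivation_in_D A.m_assoc
        inner_derivation_comp[THEN fun_cong, unfolded o_apply]\<close>)
  define w where "w y g = elem_op (x \<otimes> g) (y \<otimes> f) - sc (br f x) (elem_op g y)" for y g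
  \<comment> \<open>Composition on the right acts on the inner factors y and g with the opposite
    sign, hence the minus in \<Delta>. The starting point \<open>w x0 f0\<close> is supplied by
    \<open>first\<close>.\<close>
  have "w y g - sc (br g y) (w p p) \<in> D"
    by (rule adjoint_generation[where \<Delta> = "\<lambda>a T. - (T \<circ> \<delta> a)" and w = w,
        OF ops.vector_space_axioms D_subspace _ _ _ _ _ _ x0 f0 nil _ assms(2,4)])
      (use x0 f0 first assms in \<open>simp_all add: w_def smult_mult_left smult_mult_right elem_op_scale_left
        elem_op_scale_right fun_eq_iff scale_op_def scale_right_diff_distrib mult.commute
        D_comp D_neg inner_derivation_in_D A.m_assoc
        comp_inner_derivation[THEN fun_cong, unfolded o_apply]\<close>)
  then show ?thesis
    using assms by (simp add: w_def traceless_op_def)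
next
  case False
  then have *: "x = \<zero> \<or> f = \<zero>" if "x \<in> Ap" "f \<in> pA" "f \<otimes> x = \<zero>" for x f
    using that by blast
  obtain a b c d where "x = a \<odot> p" "y = b \<odot> p" "f = c \<odot> p" "g = d \<odot> p"
    using multiples_of_p[OF *] assms by metis
  then have "traceless_op x g y f = 0"
    by (simp add: traceless_op_def fun_eq_iff smult_mult_left smult_mult_right elem_op_scale_left
        elem_op_scale_right br_simps scale_op_def mult_ac scale_right_diff_distrib scalar_scalar)
  then show ?thesis
    by (simp only: D_zero)
qed

text \<open>The corrections match those of \<open>traceless_op\<close>. There they are the
  functionals \<Phi>, \<Psi>, \<tau> below at a b, b a and a b, for a = x \<otimes> g and b = y
  \<otimes> f; here all three are taken at c = x \<otimes> f. This is what makes them cancel in the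
  end.\<close>

definition right_op :: "'b \<Rightarrow> 'b \<Rightarrow> 'v \<Rightarrow> 'v" where
  "right_op x f = elem_op \<one> (x \<otimes> f) - elem_op x f - elem_op f x + sc (br f x) (elem_op p p)"

text \<open>The idempotent case of the next lemma is \<open>\<delta>\<^sub>q\<^sup>2 - \<delta>\<^sub>q = 2 L\<^bsub>1-q\<^esub> R\<^sub>q\<close>.\<close>

lemma right_op_in_D:
  assumes x: "x \<in> Ap" and f: "f \<in> pA"
  shows "right_op x f \<in> D"
proof (cases "f = \<zero>")
  case True
  have "br \<zero> x = 0"
    using x by (intro br_unique) simp
  then have "right_op x f = 0"
    using True x by (simp add: right_op_def)
  then show ?thesis
    by (simp only: D_zero)
next
  case False
  \<comment> \<open>For such q the element q \<otimes> f is an idempotent e; the derivation of e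
    gives [1,e] - [e,e], and \<open>traceless_op\<close> disposes of [e,e].\<close>
  have unit: "right_op q f \<in> D" if q: "q \<in> Ap" and qf: "br f q = 1" for q
  proof -
    define e where "e = q \<otimes> f"
    have "e \<otimes> e = q \<otimes> (f \<otimes> (q \<otimes> f))"
      using q f by (simp add: e_def A.m_assoc)
    then have e: "e \<in> carrier B" "e \<otimes> e = e"
      using q f qf by (simp_all add: e_def br_row)
    have "sc (1/2) ((\<delta> e \<circ> \<delta> e) - \<delta> e) + traceless_op q f q f \<in> D"
      using e q f by (intro D_add D_scale D_diff D_comp inner_derivation_in_D traceless_op_in_D)
    also have "sc (1/2) ((\<delta> e \<circ> \<delta> e) - \<delta> e) = elem_op \<one> e - elem_op e e"
    proof -
      have "(\<delta> e \<circ> \<delta> e) - \<delta> e = sc 2 (elem_op \<one> e - elem_op e e)"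
        unfolding square_inner_derivation[OF e(1)] e(2) unfolding inner_derivation_eq[OF e(1)]
        using scale_left_distrib[of 1 1]
        by (simp add: fun_eq_iff scale_op_def scale_right_diff_distrib)
      then show ?thesis by simp
    qed
    also have "elem_op \<one> e - elem_op e e + traceless_op q f q f = right_op q f"
      using qf by (simp add: traceless_op_def right_op_def e_def fun_eq_iff scale_op_def)
    finally show ?thesis .
  qed
  obtain z where z: "z \<in> Ap" "br f z = 1"
    using row_dual[OF f False] br_unique[of f _ 1] by auto
  \<comment> \<open>\<open>right_op\<close> is linear in its first argument, so x is written as q
    minus a multiple of z, where q and z both pair with f to 1.\<close>
  define q where "q = x \<oplus> (1 - br f x) \<odot> z"
  have q: "q \<in> Ap" "br f q = 1"
    using x f z by (auto simp: q_def br_simps)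
  have "right_op q f = right_op x f + sc (1 - br f x) (right_op z f)"
    using x f z unfolding q_def
    by (simp add: right_op_def fun_eq_iff A.l_distr smult_mult_left elem_op_add_left elem_op_add_right
        elem_op_scale_left elem_op_scale_right br_simps scale_op_def scale_right_diff_distrib
        scale_right_distrib scale_left_distrib scale_left_diff_distrib)
  then have "right_op x f = right_op q f - sc (1 - br f x) (right_op z f)"
    by simp
  also have "\<dots> \<in> D"
    by (intro D_diff D_scale unit q z)
  finally show ?thesis .
qed

end

section \<open>Local units\<close>

locale local_unit = bimodule_minimal_idempotent B scale lact ract p
  for B :: "(complex, 'b) module" (structure)
    and scale :: "complex \<Rightarrow> 'v::ab_group_add \<Rightarrow> 'v"
    and lact ract p +
  fixes I :: "'i set" and X Y :: "'i \<Rightarrow> 'b" and E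
  assumes finite_I [simp]: "finite I"
    and X: "i \<in> I \<Longrightarrow> X i \<in> Ap"
    and Y: "i \<in> I \<Longrightarrow> Y i \<in> pA"
  defines "E \<equiv> \<Oplus>i\<in>I. X i \<otimes> Y i"
  assumes E_X: "i \<in> I \<Longrightarrow> E \<otimes> X i = X i"
begin

lemma XY_closed [simp, intro]: "i \<in> I \<Longrightarrow> X i \<in> carrier B" "i \<in> I \<Longrightarrow> Y i \<in> carrier B"
  using X Y by blast+

lemma E_closed [simp, intro]: "E \<in> carrier B"
  unfolding E_def by (rule A.finsum_closed) auto

lemma E_mult:
  assumes "a \<in> carrier B"
  shows "E \<otimes> a = (\<Oplus>i\<in>I. X i \<otimes> (Y i \<otimes> a))"
proof -
  have "(\<Oplus>i\<in>I. X i \<otimes> Y i) \<otimes> a = (\<Oplus>i\<in>I. (X i \<otimes> Y i) \<otimes> a)"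
    using assms by (intro A.finsum_ldistr) auto
  also have "\<dots> = (\<Oplus>i\<in>I. X i \<otimes> (Y i \<otimes> a))"
    using assms by (intro A.finsum_cong') (auto simp: A.m_assoc)
  finally show ?thesis
    unfolding E_def .
qed

text \<open>A right ideal on which E is a left identity. It contains every \<open>X i\<close> by
  \<open>E_X\<close>, so its elements can be expanded as if the \<open>X i\<close> and
  \<open>Y i\<close> were finite dual bases.\<close>

definition fixed where "fixed = {a \<in> carrier B. E \<otimes> a = a}"

lemma fixed_intros:
  "\<zero> \<in> fixed"
  "a \<in> fixed \<Longrightarrow> b \<in> fixed \<Longrightarrow> a \<oplus> b \<in> fixed"
  "a \<in> fixed \<Longrightarrow> c \<odot> a \<in> fixed"
  "a \<in> fixed \<Longrightarrow> b \<in> carrier B \<Longrightarrow> a \<otimes> b \<in> fixed"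
  by (auto simp: fixed_def A.r_distr smult_mult_right simp flip: A.m_assoc)

lemma fixed_closed [simp, intro]: "a \<in> fixed \<Longrightarrow> a \<in> carrier B"
  and fixedD: "a \<in> fixed \<Longrightarrow> E \<otimes> a = a"
  and fixedI: "a \<in> carrier B \<Longrightarrow> E \<otimes> a = a \<Longrightarrow> a \<in> fixed"
  by (simp_all add: fixed_def)

text \<open>Since a = E a is the sum of the rank one elements
  \<open>X i \<otimes> (Y i \<otimes> a)\<close>, whose columns are fixed by E, additivity reduces
  claims to rank one.\<close>

lemma fixed_induct [consumes 1, case_names zero add rank_one]:
  assumes a: "a \<in> fixed" and zero: "P \<zero>"
    and add: "\<And>a b. a \<in> carrier B \<Longrightarrow> b \<in> carrier B \<Longrightarrow> P a \<Longrightarrow> P b \<Longrightarrow> P (a \<oplus> b)"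
    and rank_one: "\<And>x f. x \<in> Ap \<Longrightarrow> x \<in> fixed \<Longrightarrow> f \<in> pA \<Longrightarrow> P (x \<otimes> f)"
  shows "P a"
proof -
  have "P (\<Oplus>i\<in>J. X i \<otimes> (Y i \<otimes> a))" if "J \<subseteq> I" for J
    using finite_subset[OF that finite_I] that
  proof (induction J rule: finite_induct)
    case (insert j J)
    have J: "X i \<otimes> (Y i \<otimes> a) \<in> carrier B" if "i \<in> insert j J" for i
      using that insert.prems a by blast
    have "P (X j \<otimes> (Y j \<otimes> a) \<oplus> (\<Oplus>i\<in>J. X i \<otimes> (Y i \<otimes> a)))"
      using insert J X Y E_X a by (intro add rank_one A.finsum_closed fixedI pA_intros) auto
    then show ?case
      using insert.hyps J by (subst A.finsum_insert) auto
  qed (simp add: zero)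
  from this[of I] show ?thesis
    using E_mult[of a] fixedD[of a] a by simp
qed

text \<open>
  On a rank one element \<open>x \<otimes> f\<close> these are \<open>[x,f]\<close>, \<open>[f,x]\<close> and \<open>\<langle>f,x\<rangle> [p,p]\<close>; the local unit makes
  the values independent of how an element is written as a sum of rank one elements.
\<close>

definition \<Phi> where "\<Phi> c = (\<Sum>i\<in>I. elem_op (X i) (Y i \<otimes> c))"
definition \<Psi> where "\<Psi> c = (\<Sum>i\<in>I. elem_op (Y i \<otimes> c) (X i))"
definition \<tau> where "\<tau> c = elem_op (\<Oplus>i\<in>I. Y i \<otimes> (c \<otimes> X i)) p"

lemma functionals_add:
  assumes "c \<in> carrier B" "d \<in> carrier B"
  shows "\<Phi> (c \<oplus> d) = \<Phi> c + \<Phi> d" "\<Psi> (c \<oplus> d) = \<Psi> c + \<Psi> d" "\<tau> (c \<oplus> d) = \<tau> c + \<tau> d"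
proof -
  show "\<Phi> (c \<oplus> d) = \<Phi> c + \<Phi> d" "\<Psi> (c \<oplus> d) = \<Psi> c + \<Psi> d"
    unfolding \<Phi>_def \<Psi>_def sum.distrib[symmetric] using assms
    by (auto intro!: sum.cong simp: A.r_distr elem_op_add_left elem_op_add_right)
  have "(\<Oplus>i\<in>I. Y i \<otimes> ((c \<oplus> d) \<otimes> X i)) = (\<Oplus>i\<in>I. Y i \<otimes> (c \<otimes> X i) \<oplus> Y i \<otimes> (d \<otimes> X i))"
    using assms by (intro A.finsum_cong') (auto simp: A.r_distr A.l_distr)
  also have "\<dots> = (\<Oplus>i\<in>I. Y i \<otimes> (c \<otimes> X i)) \<oplus> (\<Oplus>i\<in>I. Y i \<otimes> (d \<otimes> X i))"
    using assms by (intro A.finsum_addf) auto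
  finally show "\<tau> (c \<oplus> d) = \<tau> c + \<tau> d"
    using assms unfolding \<tau>_def by (simp add: elem_op_add_left A.finsum_closed Pi_iff)
qed

lemma functionals_zero: "\<Phi> \<zero> = 0" "\<Psi> \<zero> = 0" "\<tau> \<zero> = 0"
  using functionals_add[of \<zero> \<zero>] by simp_all

text \<open>E x = x expands x in the \<open>X i\<close> with the coefficients
  \<open>br (Y i) x\<close>. The same scalars appear in each functional, and moving them onto
  \<open>X i\<close> collapses the sum over I.\<close>

lemma functionals_rank_one:
  assumes x: "x \<in> Ap" "x \<in> fixed" and f: "f \<in> pA"
  shows "\<Phi> (x \<otimes> f) = elem_op x f" "\<Psi> (x \<otimes> f) = elem_op f x"
    "\<tau> (x \<otimes> f) = sc (br f x) (elem_op p p)"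
proof -
  have Ex: "(\<Oplus>i\<in>I. br (Y i) x \<odot> X i) = x"
  proof -
    have "(\<Oplus>i\<in>I. br (Y i) x \<odot> X i) = (\<Oplus>i\<in>I. X i \<otimes> (Y i \<otimes> x))"
      using x X Y by (intro A.finsum_cong') (auto simp: col_br)
    then show ?thesis
      using E_mult[of x] fixedD[of x] x by simp
  qed
  have "\<Phi> (x \<otimes> f) = (\<Sum>i\<in>I. elem_op (br (Y i) x \<odot> X i) f)"
    unfolding \<Phi>_def using x f Y
    by (intro sum.cong refl) (simp add: br_row elem_op_scale_left elem_op_scale_right)
  then show "\<Phi> (x \<otimes> f) = elem_op x f"
    using f elem_op_finsum_left[of I "\<lambda>i. br (Y i) x \<odot> X i" f] Ex by (simp add: Pi_iff)
  have "\<Psi> (x \<otimes> f) = (\<Sum>i\<in>I. elem_op f (br (Y i) x \<odot> X i))"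
    unfolding \<Psi>_def using x f Y
    by (intro sum.cong refl) (simp add: br_row elem_op_scale_left elem_op_scale_right)
  then show "\<Psi> (x \<otimes> f) = elem_op f x"
    using f elem_op_finsum_right[of I "\<lambda>i. br (Y i) x \<odot> X i" f] Ex by (simp add: Pi_iff)
  have "(\<Oplus>i\<in>I. Y i \<otimes> (x \<otimes> f \<otimes> X i)) = (\<Oplus>i\<in>I. f \<otimes> (br (Y i) x \<odot> X i))"
  proof (rule A.finsum_cong'[OF refl])
    fix i assume i: "i \<in> I"
    have "Y i \<otimes> (x \<otimes> f \<otimes> X i) = Y i \<otimes> (x \<otimes> f) \<otimes> X i"
      using i x f by (simp add: A.m_assoc)
    then show "Y i \<otimes> (x \<otimes> f \<otimes> X i) = f \<otimes> (br (Y i) x \<odot> X i)"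
      using i x f Y by (simp add: br_row smult_mult_left smult_mult_right)
  qed (use f in auto)
  also have "\<dots> = f \<otimes> (\<Oplus>i\<in>I. br (Y i) x \<odot> X i)"
    using f by (intro A.finsum_rdistr[symmetric]) auto
  also have "\<dots> = br f x \<odot> p"
    using x f by (simp only: Ex mult_eq_br)
  finally show "\<tau> (x \<otimes> f) = sc (br f x) (elem_op p p)"
    by (simp add: \<tau>_def elem_op_scale_left)
qed

text \<open>On rank one elements this is \<open>traceless_op\<close>. In this form the corrections
  depend only on a b and b a, so for a list they depend only on its two products.\<close>

definition tensor_defect where
  "tensor_defect a b = elem_op a b - \<Phi> (a \<otimes> b) - \<Psi> (b \<otimes> a) + \<tau> (a \<otimes> b)"

lemma tensor_defect_add:
  assumes "a \<in> carrier B" "a' \<in> carrier B" "b \<in> carrier B"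
  shows "tensor_defect (a \<oplus> a') b = tensor_defect a b + tensor_defect a' b"
    "tensor_defect b (a \<oplus> a') = tensor_defect b a + tensor_defect b a'"
  using assms by (simp_all add: tensor_defect_def elem_op_add_left elem_op_add_right A.l_distr A.r_distr
      functionals_add fun_eq_iff)

lemma tensor_defect_zero:
  "a \<in> carrier B \<Longrightarrow> tensor_defect \<zero> a = 0" "a \<in> carrier B \<Longrightarrow> tensor_defect a \<zero> = 0"
  by (simp_all add: tensor_defect_def functionals_zero)

lemma tensor_defect_rank_one:
  assumes "x \<in> Ap" "x \<in> fixed" "y \<in> Ap" "y \<in> fixed" "f \<in> pA" "g \<in> pA"
  shows "tensor_defect (x \<otimes> g) (y \<otimes> f) = traceless_op x g y f"
proof -
  have "x \<otimes> g \<otimes> (y \<otimes> f) = (br g y \<odot> x) \<otimes> f" "y \<otimes> f \<otimes> (x \<otimes> g) = (br f x \<odot> y) \<otimes> g"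
    using assms by (simp_all add: A.m_assoc br_row smult_mult_left smult_mult_right)
  then show ?thesis
    using assms
    by (simp add: tensor_defect_def traceless_op_def functionals_rank_one fixed_intros br_simps
        elem_op_scale_left elem_op_scale_right fun_eq_iff scale_op_def scale_right_diff_distrib)
qed

lemma tensor_defect_in_D:
  assumes "a \<in> fixed" "b \<in> fixed"
  shows "tensor_defect a b \<in> D"
  using assms(1)
proof (induction rule: fixed_induct)
  case zero
  then show ?case using assms by (simp only: tensor_defect_zero fixed_closed D_zero)
next
  case (add a a')
  then show ?case using assms by (simp only: tensor_defect_add fixed_closed D_add)
next
  case (rank_one x g)
  show ?case
    using assms(2)
  proof (induction rule: fixed_induct)
    case zero
    then show ?case using rank_one by (simp only: tensor_defect_zero A.m_closed Ap_closed pA_closed D_zero)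
  next
    case (add a a')
    then show ?case using rank_one by (simp only: tensor_defect_add A.m_closed Ap_closed pA_closed D_add)
  next
    case (rank_one y f)
    then show ?case
      using \<open>x \<in> Ap\<close> \<open>x \<in> fixed\<close> \<open>g \<in> pA\<close> by (simp only: tensor_defect_rank_one traceless_op_in_D)
  qed
qed

definition right_defect where
  "right_defect c = elem_op \<one> c - \<Phi> c - \<Psi> c + \<tau> c"

lemma right_defect_in_D:
  assumes "c \<in> fixed"
  shows "right_defect c \<in> D"
  using assms
proof (induction rule: fixed_induct)
  case zero
  have "right_defect \<zero> = 0" by (simp add: right_defect_def functionals_zero)
  then show ?case by (simp only: D_zero)
next
  case (add a b)
  then have "right_defect (a \<oplus> b) = right_defect a + right_defect b"
    by (simp add: right_defect_def functionals_add elem_op_add_right fun_eq_iff)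
  then show ?case using add by (simp only: D_add)
next
  case (rank_one x f)
  then have "right_defect (x \<otimes> f) = right_op x f"
    by (simp add: right_defect_def right_op_def functionals_rank_one)
  then show ?case using rank_one by (simp only: right_op_in_D)
qed

lemma pairs_op_fixed:
  assumes "set ps \<subseteq> fixed \<times> fixed"
  shows "pairs_op ps - \<Phi> (pairs_prod ps) - \<Psi> (pairs_rev_prod ps) + \<tau> (pairs_prod ps) \<in> D"
  using assms
proof (induction ps)
  case Nil
  have "pairs_op [] - \<Phi> (pairs_prod []) - \<Psi> (pairs_rev_prod []) + \<tau> (pairs_prod []) = 0"
    by (simp add: functionals_zero)
  then show ?case by (simp only: D_zero)
next
  case (Cons q ps)
  obtain a b where q: "q = (a, b)" by force
  have ab: "a \<in> fixed" "b \<in> fixed" and ps: "set ps \<subseteq> fixed \<times> fixed" "set ps \<subseteq> carrier B \<times> carrier B"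
    using Cons.prems by (auto simp: q)
  have "tensor_defect a b +
      (pairs_op ps - \<Phi> (pairs_prod ps) - \<Psi> (pairs_rev_prod ps) + \<tau> (pairs_prod ps)) \<in> D"
    by (rule D_add[OF tensor_defect_in_D[OF ab] Cons.IH[OF ps(1)]])
  also have "tensor_defect a b +
      (pairs_op ps - \<Phi> (pairs_prod ps) - \<Psi> (pairs_rev_prod ps) + \<tau> (pairs_prod ps)) =
      pairs_op (q # ps) - \<Phi> (pairs_prod (q # ps)) - \<Psi> (pairs_rev_prod (q # ps)) + \<tau> (pairs_prod (q # ps))"
    using ab ps(2) by (simp add: q tensor_defect_def functionals_add fun_eq_iff)
  finally show ?case .
qed

lemma pairs_prod_fixed:
  assumes "set ps \<subseteq> fixed \<times> fixed"
  shows "pairs_prod ps \<in> fixed" "pairs_rev_prod ps \<in> fixed"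
  using assms by (induction ps) (auto intro!: fixed_intros)

text \<open>Expanding (a' + \<alpha>)(b' + \<beta>) and its reverse gives a' b' or b' a' plus the
  same remainder, since scalars are central. Terms with the unit on one side are gathered in u and
  v.\<close>

lemma split_scalars:
  assumes "\<And>a b. (a, b) \<in> set ps \<Longrightarrow> (\<exists>a'\<in>fixed. \<exists>\<alpha>. a = a' \<oplus> \<alpha> \<odot> \<one>) \<and> (\<exists>b'\<in>fixed. \<exists>\<beta>. b = b' \<oplus> \<beta> \<odot> \<one>)"
  shows "\<exists>qs u v \<gamma>. set qs \<subseteq> fixed \<times> fixed \<and> u \<in> fixed \<and> v \<in> fixed \<and>
    pairs_op ps = pairs_op qs + (elem_op u \<one> + (elem_op \<one> v + sc \<gamma> (elem_op \<one> \<one>))) \<and>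
    pairs_prod ps = pairs_prod qs \<oplus> (u \<oplus> v \<oplus> \<gamma> \<odot> \<one>) \<and>
    pairs_rev_prod ps = pairs_rev_prod qs \<oplus> (u \<oplus> v \<oplus> \<gamma> \<odot> \<one>)"
  using assms
proof (induction ps)
  case Nil
  show ?case
    by (rule exI[of _ "[]"], rule exI[of _ \<zero>], rule exI[of _ \<zero>], rule exI[of _ 0])
      (simp add: fixed_intros)
next
  case (Cons q ps)
  obtain a b where q: "q = (a, b)" by force
  obtain qs u v \<gamma> where IH: "set qs \<subseteq> fixed \<times> fixed" "u \<in> fixed" "v \<in> fixed"
    "pairs_op ps = pairs_op qs + (elem_op u \<one> + (elem_op \<one> v + sc \<gamma> (elem_op \<one> \<one>)))"
    "pairs_prod ps = pairs_prod qs \<oplus> (u \<oplus> v \<oplus> \<gamma> \<odot> \<one>)"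
    "pairs_rev_prod ps = pairs_rev_prod qs \<oplus> (u \<oplus> v \<oplus> \<gamma> \<odot> \<one>)"
    using Cons.IH Cons.prems by (metis list.set_intros(2))
  obtain a' \<alpha> b' \<beta> where ab: "a' \<in> fixed" "b' \<in> fixed" "a = a' \<oplus> \<alpha> \<odot> \<one>" "b = b' \<oplus> \<beta> \<odot> \<one>"
    using Cons.prems[of a b] q by auto
  have qs: "pairs_prod qs \<in> carrier B" "pairs_rev_prod qs \<in> carrier B"
    using pairs_prod_fixed[OF IH(1)] by auto
  let ?u = "\<beta> \<odot> a' \<oplus> u" and ?v = "\<alpha> \<odot> b' \<oplus> v"
  have mult: "a \<otimes> b = a' \<otimes> b' \<oplus> (\<beta> \<odot> a' \<oplus> \<alpha> \<odot> b' \<oplus> (\<alpha> * \<beta>) \<odot> \<one>)"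
    "b \<otimes> a = b' \<otimes> a' \<oplus> (\<beta> \<odot> a' \<oplus> \<alpha> \<odot> b' \<oplus> (\<alpha> * \<beta>) \<odot> \<one>)"
    using ab by (simp_all add: A.l_distr A.r_distr smult_mult_left smult_mult_right scalar_scalar
        scalar_add_right A.a_ac mult.commute)
  have op: "elem_op a b = elem_op a' b' + (elem_op (\<beta> \<odot> a') \<one> + (elem_op \<one> (\<alpha> \<odot> b') + sc (\<alpha> * \<beta>) (elem_op \<one> \<one>)))"
    using ab
    by (simp add: elem_op_add_left elem_op_add_right elem_op_scale_left elem_op_scale_right
        ops.scale_right_distrib mult.commute add.assoc)
  have "set ((a', b') # qs) \<subseteq> fixed \<times> fixed" "?u \<in> fixed" "?v \<in> fixed"
    using IH ab by (auto intro!: fixed_intros)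
  moreover have "pairs_op (q # ps) = pairs_op ((a', b') # qs) +
      (elem_op ?u \<one> + (elem_op \<one> ?v + sc (\<alpha> * \<beta> + \<gamma>) (elem_op \<one> \<one>)))"
    using IH(2,3) ab(1,2)
    by (simp add: q op IH(4) elem_op_add_left elem_op_add_right fun_eq_iff scale_op_def scale_left_distrib)
  moreover have "pairs_prod (q # ps) = pairs_prod ((a', b') # qs) \<oplus> (?u \<oplus> ?v \<oplus> (\<alpha> * \<beta> + \<gamma>) \<odot> \<one>)"
    "pairs_rev_prod (q # ps) = pairs_rev_prod ((a', b') # qs) \<oplus> (?u \<oplus> ?v \<oplus> (\<alpha> * \<beta> + \<gamma>) \<odot> \<one>)"
    using IH(2,3) ab(1,2) qs
    by (simp_all add: q mult IH(5,6) scalar_add_left A.a_ac)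
  ultimately show ?case
    by blast
qed

text \<open>If E is the unit, everything is fixed and the corrections vanish with the products.
  Otherwise the unit is not fixed, so \<gamma> vanishes and both products of the fixed part equal
  -(u + v); \<open>right_defect\<close> then supplies exactly the opposite corrections.\<close>

lemma pairs_op_in_D:
  assumes ps: "set ps \<subseteq> carrier B \<times> carrier B"
    and prods: "pairs_prod ps = \<zero>" "pairs_rev_prod ps = \<zero>"
    and split: "\<And>a b. (a, b) \<in> set ps \<Longrightarrow> (\<exists>a'\<in>fixed. \<exists>\<alpha>. a = a' \<oplus> \<alpha> \<odot> \<one>) \<and> (\<exists>b'\<in>fixed. \<exists>\<beta>. b = b' \<oplus> \<beta> \<odot> \<one>)"
  shows "pairs_op ps \<in> D"
proof (cases "E = \<one>")
  case True
  then have "set ps \<subseteq> fixed \<times> fixed"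
    using ps fixedI True by (auto simp: subset_iff)
  from pairs_op_fixed[OF this] show ?thesis
    by (simp add: prods functionals_zero)
next
  case False
  obtain qs u v \<gamma> where qs: "set qs \<subseteq> fixed \<times> fixed" and uv: "u \<in> fixed" "v \<in> fixed"
    and op: "pairs_op ps = pairs_op qs + (elem_op u \<one> + (elem_op \<one> v + sc \<gamma> (elem_op \<one> \<one>)))"
    and eqs: "pairs_prod ps = pairs_prod qs \<oplus> (u \<oplus> v \<oplus> \<gamma> \<odot> \<one>)"
      "pairs_rev_prod ps = pairs_rev_prod qs \<oplus> (u \<oplus> v \<oplus> \<gamma> \<odot> \<one>)"
    using split_scalars[OF split] by blast
  define m m' c where "m = pairs_prod qs" and "m' = pairs_rev_prod qs" and "c = u \<oplus> v"
  have fixed: "m \<in> fixed" "m' \<in> fixed" "c \<in> fixed"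
    using pairs_prod_fixed[OF qs] uv by (auto simp: m_def m'_def c_def intro: fixed_intros)
  have sums: "m \<oplus> c \<oplus> \<gamma> \<odot> \<one> = \<zero>" "m' \<oplus> c \<oplus> \<gamma> \<odot> \<one> = \<zero>"
    using eqs prods fixed uv by (simp_all add: m_def m'_def c_def A.a_assoc)
  have "\<gamma> = 0"
  proof (rule ccontr)
    assume "\<gamma> \<noteq> 0"
    have mc: "m \<oplus> c \<in> fixed"
      using fixed by (intro fixed_intros)
    have "\<gamma> \<odot> \<one> = \<ominus> (m \<oplus> c)"
      using sums(1) fixed by (metis A.a_comm A.minus_equality A.add.m_closed A.one_closed fixed_closed scalar_closed)
    then have "\<gamma> \<odot> \<one> \<in> fixed"
      using mc by (metis fixed_intros(3) fixed_closed scalar_minus_one)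
    then have "inverse \<gamma> \<odot> (\<gamma> \<odot> \<one>) \<in> fixed"
      by (rule fixed_intros)
    then have "\<one> \<in> fixed"
      using \<open>\<gamma> \<noteq> 0\<close> by (simp add: scalar_scalar)
    then show False
      using False fixedD[of \<one>] by simp
  qed
  then have zero: "m \<oplus> c = \<zero>" "m' \<oplus> c = \<zero>"
    using sums fixed by simp_all
  have cancel: "\<Phi> m + \<Phi> c = 0" "\<Psi> m' + \<Psi> c = 0" "\<tau> m + \<tau> c = 0"
    using functionals_add[of m c] functionals_add[of m' c] functionals_zero zero fixed by auto
  \<comment> \<open>[u,1] + [1,v] equals \<open>\<delta> u\<close> plus [1,u + v], which leaves a
    single operator of the form [1,c].\<close>
  have "(pairs_op qs - \<Phi> m - \<Psi> m' + \<tau> m) + \<delta> u + right_defect c \<in> D"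
    unfolding m_def m'_def using uv fixed(3)
    by (intro D_add pairs_op_fixed qs inner_derivation_in_D right_defect_in_D) auto
  also have "(pairs_op qs - \<Phi> m - \<Psi> m' + \<tau> m) + \<delta> u + right_defect c =
      pairs_op qs + (elem_op u \<one> + elem_op \<one> v) - (\<Phi> m + \<Phi> c) - (\<Psi> m' + \<Psi> c) + (\<tau> m + \<tau> c)"
    using uv by (simp add: right_defect_def inner_derivation_eq elem_op_add_right c_def algebra_simps)
  also have "\<dots> = pairs_op ps"
    by (simp add: cancel op \<open>\<gamma> = 0\<close>)
  finally show ?thesis .
qed

end

text \<open>An operator in \<open>M\<close> involves only finitely many elements of B, so the local
  unit may depend on them. This matters on a space of infinite dimension, where no finite sum of
  rank one operators is the identity.\<close>

lemma (in bimodule_minimal_idempotent) D_eq_M_if_local_units: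
  assumes "\<And>S. finite S \<Longrightarrow> S \<subseteq> carrier B \<Longrightarrow> \<exists>(I :: 'i set) X Y. finite I \<and>
    (\<forall>i\<in>I. X i \<in> Ap \<and> Y i \<in> pA \<and> (\<Oplus>i\<in>I. X i \<otimes> Y i) \<otimes> X i = X i) \<and>
    (\<forall>a\<in>S. \<exists>a'\<in>carrier B. \<exists>\<alpha>. (\<Oplus>i\<in>I. X i \<otimes> Y i) \<otimes> a' = a' \<and> a = a' \<oplus> \<alpha> \<odot> \<one>)"
  shows "D = M"
proof (rule equalityI[OF D_subset_M], rule subsetI)
  fix T assume "T \<in> M"
  then obtain ps where ps: "set ps \<subseteq> carrier B \<times> carrier B" "pairs_prod ps = \<zero>"
    "pairs_rev_prod ps = \<zero>" "T = pairs_op ps"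
    unfolding M_Lie_eq by blast
  let ?S = "fst ` set ps \<union> snd ` set ps"
  obtain I :: "'i set" and X Y where I: "finite I"
    "\<forall>i\<in>I. X i \<in> Ap \<and> Y i \<in> pA \<and> (\<Oplus>i\<in>I. X i \<otimes> Y i) \<otimes> X i = X i"
    "\<forall>a\<in>?S. \<exists>a'\<in>carrier B. \<exists>\<alpha>. (\<Oplus>i\<in>I. X i \<otimes> Y i) \<otimes> a' = a' \<and> a = a' \<oplus> \<alpha> \<odot> \<one>"
  proof -
    have "finite ?S" "?S \<subseteq> carrier B"
      using ps(1) by auto
    from assms[OF this] that show thesis
      by blast
  qed
  interpret local_unit B scale lact ract p I X Y "\<Oplus>i\<in>I. X i \<otimes> Y i"
  proof (intro local_unit.intro bimodule_minimal_idempotent_axioms local_unit_axioms.intro)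
    show "finite I" by (rule I)
  next
    fix i assume "i \<in> I"
    note Ii = bspec[OF I(2) this]
    show "X i \<in> Ap" by (rule conjunct1[OF Ii])
    show "Y i \<in> pA" by (rule conjunct1[OF conjunct2[OF Ii]])
    show "(\<Oplus>i\<in>I. X i \<otimes> Y i) \<otimes> X i = X i" by (rule conjunct2[OF conjunct2[OF Ii]])
  qed
  have "\<exists>a'\<in>fixed. \<exists>\<alpha>. a = a' \<oplus> \<alpha> \<odot> \<one>" if "a \<in> ?S" for a
    using bspec[OF I(3) that] by (elim bexE exE conjE) (rule bexI[OF _ fixedI], rule exI)
  then show "T \<in> D"
    unfolding ps(4) by (intro pairs_op_in_D ps(1-3)) force+
qed

section \<open>Matrices and finite-rank operators\<close>

definition mat_unit :: "nat \<Rightarrow> nat \<Rightarrow> nat \<Rightarrow> complex mat" where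
  "mat_unit n i j = mat n n (\<lambda>(r, s). if r = i \<and> s = j then 1 else 0)"

lemma mat_unit_carrier [simp, intro]: "mat_unit n i j \<in> carrier_mat n n"
  by (simp add: mat_unit_def)

lemma mat_unit_mult_left:
  assumes "A \<in> carrier_mat n n" "j < n"
  shows "mat_unit n i j * A = mat n n (\<lambda>(r, s). if r = i then A $$ (j, s) else 0)"
  using assms by (intro eq_matI) (auto simp: mat_unit_def scalar_prod_def if_distrib[of "\<lambda>x. x * _"] sum.delta cong: if_cong)

lemma mat_unit_mult_right:
  assumes "A \<in> carrier_mat n n" "k < n"
  shows "A * mat_unit n k l = mat n n (\<lambda>(r, s). if s = l then A $$ (r, k) else 0)"
  using assms by (intro eq_matI) (auto simp: mat_unit_def scalar_prod_def if_distrib[of "\<lambda>x. _ * x"] sum.delta cong: if_cong)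

lemma mat_unit_sandwich:
  assumes "A \<in> carrier_mat n n" "i < n" "j < n" "k < n" "l < n"
  shows "mat_unit n i j * A * mat_unit n k l = A $$ (j, k) \<cdot>\<^sub>m mat_unit n i l"
proof -
  have "mat_unit n i j * A \<in> carrier_mat n n"
    using assms by (intro mult_carrier_mat[of _ n n]) auto
  then show ?thesis
    using assms(2-5) unfolding mat_unit_mult_right[OF _ assms(4)] mat_unit_mult_left[OF assms(1,3)]
    by (subst mat_unit_mult_right) (auto intro!: eq_matI simp: mat_unit_def)
qed

lemma mat_unit_mult:
  assumes "i < n" "j < n" "k < n" "l < n"
  shows "mat_unit n i j * mat_unit n k l = (if j = k then mat_unit n i l else 0\<^sub>m n n)"
  using assms by (subst mat_unit_mult_left) (auto simp: mat_unit_def)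

lemma minimal_idempotent_matrix_algebra:
  assumes "n \<ge> 1"
  shows "minimal_idempotent (matrix_algebra n) (mat_unit n 0 0)"
proof -
  have n: "0 < n" using assms by simp
  interpret unital_algebra "matrix_algebra n"
    by (rule unital_algebra_matrix_algebra)
  note fields = matrix_algebra_def module.simps ring.simps monoid.simps partial_object.simps
  have nz: "mat_unit n 0 0 \<noteq> 0\<^sub>m n n"
  proof
    assume "mat_unit n 0 0 = 0\<^sub>m n n"
    then have "mat_unit n 0 0 $$ (0, 0) = 0" using n by simp
    then show False using n by (simp add: mat_unit_def)
  qed
  show ?thesis
  proof (unfold_locales; unfold fields)
    show "mat_unit n 0 0 \<in> carrier_mat n n" by simp
    show "mat_unit n 0 0 \<noteq> 0\<^sub>m n n" by (rule nz)
    show "mat_unit n 0 0 * mat_unit n 0 0 = mat_unit n 0 0"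
      using n by (simp add: mat_unit_mult)
    show "\<exists>c. mat_unit n 0 0 * a * mat_unit n 0 0 = c \<cdot>\<^sub>m mat_unit n 0 0" if "a \<in> carrier_mat n n" for a
      using mat_unit_sandwich[OF that n n n n] by blast
    show "\<exists>h\<in>carrier_mat n n. \<exists>z\<in>carrier_mat n n. mat_unit n 0 0 * h * a * z * mat_unit n 0 0 \<noteq> 0\<^sub>m n n"
      if a: "a \<in> carrier_mat n n" "a \<noteq> 0\<^sub>m n n" for a
    proof -
      \<comment> \<open>The unit at (0, r) moves the row of a nonzero entry to the first place and
        the unit at (s, 0) its column, so the entry survives in the corner.\<close>
      obtain r s where rs: "r < n" "s < n" "a $$ (r, s) \<noteq> 0"
        using a by (metis carrier_matD eq_matI index_zero_mat)
      have "mat_unit n 0 0 * mat_unit n 0 r * a * mat_unit n s 0 * mat_unit n 0 0 =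
          a $$ (r, s) \<cdot>\<^sub>m (mat_unit n 0 0 * mat_unit n 0 0)"
        using n rs a by (simp add: mat_unit_mult mat_unit_sandwich mult_smult_assoc_mat[of _ n n _ n])
      also have "\<dots> \<noteq> 0\<^sub>m n n"
      proof
        assume "a $$ (r, s) \<cdot>\<^sub>m (mat_unit n 0 0 * mat_unit n 0 0) = 0\<^sub>m n n"
        then have "(a $$ (r, s) \<cdot>\<^sub>m mat_unit n 0 0) $$ (0, 0) = 0"
          using n by (simp add: mat_unit_mult)
        then show False using n rs by (simp add: mat_unit_def)
      qed
      finally show ?thesis
        by blast
    qed
  qed
qed

lemma sum_mat_unit_diagonal:
  "(\<Oplus>\<^bsub>matrix_algebra n\<^esub>i\<in>{..<n}. mat_unit n i i) = 1\<^sub>m n"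
proof -
  interpret unital_algebra "matrix_algebra n"
    by (rule unital_algebra_matrix_algebra)
  have carrier: "carrier (matrix_algebra n) = carrier_mat n n" "add (matrix_algebra n) = (+)"
    "zero (matrix_algebra n) = 0\<^sub>m n n"
    by (simp_all add: matrix_algebra_def)
  have "(\<Oplus>\<^bsub>matrix_algebra n\<^esub>i\<in>{..<k}. mat_unit n i i) = mat n n (\<lambda>(r, s). if r = s \<and> r < k then 1 else 0)" for k
  proof (induction k)
    case 0
    show ?case by (auto simp: carrier)
  next
    case (Suc k)
    have "(\<Oplus>\<^bsub>matrix_algebra n\<^esub>i\<in>{..<Suc k}. mat_unit n i i) =
        mat_unit n k k + (\<Oplus>\<^bsub>matrix_algebra n\<^esub>i\<in>{..<k}. mat_unit n i i)"
      unfolding lessThan_Suc by (subst A.finsum_insert) (auto simp: carrier)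
    also have "\<dots> = mat n n (\<lambda>(r, s). if r = s \<and> r < Suc k then 1 else 0)"
      unfolding Suc.IH by (rule eq_matI) (auto simp: mat_unit_def)
    finally show ?case .
  qed
  from this[of n] show ?thesis
    by (auto simp: intro!: eq_matI)
qed

text \<open>The units in the first column and the first row give E = 1, one local unit that serves
  every S; the scalar parts are taken to be zero.\<close>

lemma D_Lie_eq_M_Lie_matrix_algebra:
  assumes n: "n \<ge> 1" and "unital_bimodule (matrix_algebra n) scale lact ract"
  shows "D_Lie (matrix_algebra n) scale lact ract = M_Lie (matrix_algebra n) lact ract"
proof -
  let ?p = "mat_unit n 0 0"
  interpret bimodule_minimal_idempotent "matrix_algebra n" scale lact ract ?p
    by (intro bimodule_minimal_idempotent.intro assms minimal_idempotent_matrix_algebra n)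
  have fields: "carrier (matrix_algebra n) = carrier_mat n n" "mult (matrix_algebra n) = (*)"
    "one (matrix_algebra n) = 1\<^sub>m n"
    by (simp_all add: matrix_algebra_def)
  have E: "(\<Oplus>\<^bsub>matrix_algebra n\<^esub>i\<in>{..<n}. mat_unit n i 0 \<otimes>\<^bsub>matrix_algebra n\<^esub> mat_unit n 0 i) = \<one>\<^bsub>matrix_algebra n\<^esub>"
  proof -
    have "(\<Oplus>\<^bsub>matrix_algebra n\<^esub>i\<in>{..<n}. mat_unit n i 0 \<otimes>\<^bsub>matrix_algebra n\<^esub> mat_unit n 0 i) =
        (\<Oplus>\<^bsub>matrix_algebra n\<^esub>i\<in>{..<n}. mat_unit n i i)"
      using n by (intro A.finsum_cong') (auto simp: fields mat_unit_mult)
    then show ?thesis by (simp only: sum_mat_unit_diagonal fields)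
  qed
  show ?thesis
  proof (rule D_eq_M_if_local_units)
    fix S assume S: "S \<subseteq> carrier (matrix_algebra n)"
    have XY: "mat_unit n i 0 \<in> Ap" "mat_unit n 0 i \<in> pA" if "i < n" for i
      using that n by (simp_all add: Ap_def pA_def fields mat_unit_mult)
    have "\<exists>a'\<in>carrier (matrix_algebra n). \<exists>\<alpha>. \<one>\<^bsub>matrix_algebra n\<^esub> \<otimes>\<^bsub>matrix_algebra n\<^esub> a' = a' \<and>
        a = a' \<oplus>\<^bsub>matrix_algebra n\<^esub> \<alpha> \<odot>\<^bsub>matrix_algebra n\<^esub> \<one>\<^bsub>matrix_algebra n\<^esub>" if "a \<in> S" for a
      using S that by (intro bexI[of _ a] exI[of _ 0]) auto
    then show "\<exists>(I :: nat set) X Y. finite I \<and>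
      (\<forall>i\<in>I. X i \<in> Ap \<and> Y i \<in> pA \<and> (\<Oplus>\<^bsub>matrix_algebra n\<^esub>i\<in>I. X i \<otimes>\<^bsub>matrix_algebra n\<^esub> Y i) \<otimes>\<^bsub>matrix_algebra n\<^esub> X i = X i) \<and>
      (\<forall>a\<in>S. \<exists>a'\<in>carrier (matrix_algebra n). \<exists>\<alpha>. (\<Oplus>\<^bsub>matrix_algebra n\<^esub>i\<in>I. X i \<otimes>\<^bsub>matrix_algebra n\<^esub> Y i) \<otimes>\<^bsub>matrix_algebra n\<^esub> a' = a'
        \<and> a = a' \<oplus>\<^bsub>matrix_algebra n\<^esub> \<alpha> \<odot>\<^bsub>matrix_algebra n\<^esub> \<one>\<^bsub>matrix_algebra n\<^esub>)"
      by (intro exI[of _ "{..<n}"] exI[of _ "\<lambda>i. mat_unit n i 0"] exI[of _ "\<lambda>i. mat_unit n 0 i"])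
        (simp add: E XY)
  qed
qed

section \<open>Finite-rank operators and coordinates in a basis\<close>

lemma finite_rank_unitization_simps:
  "carrier (finite_rank_unitization s) = {\<lambda>x. T x + s c x | T c. T \<in> finite_rank_operators s}"
  "mult (finite_rank_unitization s) = (\<circ>)"
  "one (finite_rank_unitization s) = id"
  "zero (finite_rank_unitization s) = (\<lambda>x. 0)"
  "add (finite_rank_unitization s) = (\<lambda>S T x. S x + T x)"
  "smult (finite_rank_unitization s) = (\<lambda>c T x. s c (T x))"
  by (simp_all add: finite_rank_unitization_def operator_algebra_def)

locale vector_space_basis = vector_space s
  for s :: "complex \<Rightarrow> 'x::ab_group_add \<Rightarrow> 'x" +
  fixes \<beta> :: "'x set"
  assumes independent_\<beta>: "independent \<beta>" and span_\<beta>: "span \<beta> = UNIV"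
begin

sublocale F: unital_algebra "finite_rank_unitization s"
  by (rule unital_algebra_finite_rank_unitization) (rule vector_space_axioms)

abbreviation rep :: "'x \<Rightarrow> 'x \<Rightarrow> complex" where "rep \<equiv> representation \<beta>"

lemma rep_simps:
  "rep (x + y) b = rep x b + rep y b" "rep (s c x) b = c * rep x b"
  by (simp_all add: representation_add[OF independent_\<beta>] representation_scale[OF independent_\<beta>] span_\<beta>)

lemma rep_basis: "b \<in> \<beta> \<Longrightarrow> rep b c = (if c = b then 1 else 0)"
  by (simp add: representation_basis[OF independent_\<beta>])

lemma sum_rep:
  assumes "finite J" "\<And>b. rep x b \<noteq> 0 \<Longrightarrow> b \<in> J"
  shows "(\<Sum>b\<in>J. s (rep x b) b) = x"
proof -
  have "(\<Sum>b\<in>J. s (rep x b) b) = (\<Sum>b | rep x b \<noteq> 0. s (rep x b) b)"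
    using assms by (intro sum.mono_neutral_right) auto
  then show ?thesis
    using sum_nonzero_representation_eq[OF independent_\<beta>, of x] by (simp add: span_\<beta>)
qed

text \<open>The matrix units of the basis: for e in \<beta>, \<open>op_unit e e\<close> is the
  projection on the line of e along the other basis vectors.\<close>

definition op_unit :: "'x \<Rightarrow> 'x \<Rightarrow> 'x \<Rightarrow> 'x" where
  "op_unit b c = (\<lambda>x. s (rep x c) b)"

lemma op_unit_linear: "Vector_Spaces.linear s s (op_unit b c)"
  by (rule operatorI) (simp_all add: op_unit_def rep_simps scale_left_distrib)

lemma op_unit_carrier [simp, intro]: "op_unit b c \<in> carrier (finite_rank_unitization s)"
proof -
  have "op_unit b c \<in> finite_rank_operators s"
    by (rule finite_rank_operatorsI[where F = "{b}"], rule op_unit_linear)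
      (auto simp only: op_unit_def finite.intros intro!: span_scale[OF span_base])
  then show ?thesis
    unfolding finite_rank_unitization_simps
    by (intro CollectI exI[of _ "op_unit b c"] exI[of _ 0]) simp
qed

lemma carrier_linear:
  assumes "T \<in> carrier (finite_rank_unitization s)"
  shows "Vector_Spaces.linear s s T"
proof -
  obtain T' c where T: "T = (\<lambda>x. T' x + s c x)" "T' \<in> finite_rank_operators s"
    using assms unfolding finite_rank_unitization_simps by blast
  then have "Vector_Spaces.linear s s T'"
    by (elim finite_rank_operatorsE)
  then show ?thesis
    unfolding T(1)
    by (intro operatorI) (simp_all add: operator_simps scale_right_distrib scale_left_commute)
qed

lemma op_unit_sandwich:
  assumes "Vector_Spaces.linear s s T"
  shows "op_unit a b \<circ> T \<circ> op_unit c d = (\<lambda>x. s (rep (T c) b) (op_unit a d x))"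
  by (simp add: fun_eq_iff op_unit_def operator_simps[OF assms] rep_simps mult.commute)

lemma op_unit_mult:
  "c \<in> \<beta> \<Longrightarrow> op_unit a b \<circ> op_unit c d = (if b = c then op_unit a d else (\<lambda>x. 0))"
  by (auto simp: fun_eq_iff op_unit_def rep_simps rep_basis)

lemma minimal_idempotent_finite_rank_unitization:
  assumes e: "e \<in> \<beta>"
  shows "minimal_idempotent (finite_rank_unitization s) (op_unit e e)"
proof (unfold_locales)
  have e_nz: "e \<noteq> 0"
    using e independent_\<beta> dependent_zero by blast
  have p_nz: "op_unit e e \<noteq> (\<lambda>x. 0)"
    using e_nz e by (auto simp: fun_eq_iff op_unit_def rep_basis intro!: exI[of _ e])
  show "op_unit e e \<in> carrier (finite_rank_unitization s)" by simp
  show "op_unit e e \<noteq> \<zero>\<^bsub>finite_rank_unitization s\<^esub>"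
    using p_nz by (simp only: finite_rank_unitization_simps not_False_eq_True)
  show "op_unit e e \<otimes>\<^bsub>finite_rank_unitization s\<^esub> op_unit e e = op_unit e e"
    using e by (simp add: finite_rank_unitization_simps(2) op_unit_mult)
  fix T assume T: "T \<in> carrier (finite_rank_unitization s)"
  note T_linear = carrier_linear[OF T]
  show "\<exists>c. op_unit e e \<otimes>\<^bsub>finite_rank_unitization s\<^esub> T \<otimes>\<^bsub>finite_rank_unitization s\<^esub> op_unit e e =
      c \<odot>\<^bsub>finite_rank_unitization s\<^esub> op_unit e e"
    unfolding finite_rank_unitization_simps op_unit_sandwich[OF T_linear] by blast
  assume "T \<noteq> \<zero>\<^bsub>finite_rank_unitization s\<^esub>"
  then obtain x where x: "T x \<noteq> 0"
    by (auto simp: finite_rank_unitization_simps(4))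
  \<comment> \<open>A linear operator that vanishes on the basis is zero, so T c is nonzero for some
    basis vector c, and it has a nonzero coordinate at some b. \<open>op_unit e b\<close> and
    \<open>op_unit c e\<close> carry that coefficient to the corner.\<close>
  obtain c where c: "c \<in> \<beta>" "T c \<noteq> 0"
  proof (rule ccontr)
    assume *: "\<not> thesis"
    interpret T: Vector_Spaces.linear s s T by (rule T_linear)
    have "T x = 0"
    proof (rule T.eq_0_on_span)
      show "x \<in> span \<beta>" by (simp add: span_\<beta>)
    qed (use * that in blast)
    then show False using x by simp
  qed
  obtain b where b: "rep (T c) b \<noteq> 0"
    using sum_rep[of "{}" "T c"] c by auto
  have eq: "op_unit e e \<circ> op_unit e b \<circ> T \<circ> op_unit c e \<circ> op_unit e e = (\<lambda>x. s (rep (T c) b) (op_unit e e x))"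
  proof -
    have "op_unit e e \<circ> op_unit e b = op_unit e b"
      using e by (simp add: op_unit_mult)
    moreover have "op_unit c e \<circ> op_unit e e = op_unit c e"
      using e by (simp add: op_unit_mult)
    ultimately show ?thesis
      by (metis comp_assoc op_unit_sandwich[OF T_linear])
  qed
  have "(\<lambda>x. s (rep (T c) b) (op_unit e e x)) \<noteq> (\<lambda>x. 0)"
    using p_nz b by (auto simp: fun_eq_iff)
  then have "op_unit e e \<circ> op_unit e b \<circ> T \<circ> op_unit c e \<circ> op_unit e e \<noteq> (\<lambda>x. 0)"
    by (simp only: eq not_False_eq_True)
  then show "\<exists>h\<in>carrier (finite_rank_unitization s). \<exists>z\<in>carrier (finite_rank_unitization s).
      op_unit e e \<otimes>\<^bsub>finite_rank_unitization s\<^esub> h \<otimes>\<^bsub>finite_rank_unitization s\<^esub> T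
        \<otimes>\<^bsub>finite_rank_unitization s\<^esub> z \<otimes>\<^bsub>finite_rank_unitization s\<^esub> op_unit e e
      \<noteq> \<zero>\<^bsub>finite_rank_unitization s\<^esub>"
    unfolding finite_rank_unitization_simps(2,4)
    by (intro bexI[of _ "op_unit e b"] bexI[of _ "op_unit c e"] op_unit_carrier)
qed

lemma finsum_finite_rank_unitization:
  assumes "finite J" "f \<in> J \<rightarrow> carrier (finite_rank_unitization s)"
  shows "(\<Oplus>\<^bsub>finite_rank_unitization s\<^esub>j\<in>J. f j) = (\<lambda>x. \<Sum>j\<in>J. f j x)"
  using assms
  by (induction J) (simp_all add: finite_rank_unitization_simps(4,5))

text \<open>With all finite-rank parts mapping into one finitely generated subspace, a single
  projection that fixes this subspace is a left unit for them.\<close>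

lemma common_finite_range:
  assumes "finite S" "S \<subseteq> carrier (finite_rank_unitization s)"
  shows "\<exists>G. finite G \<and> (\<forall>T\<in>S. \<exists>T'\<in>finite_rank_operators s. \<exists>c. T = (\<lambda>x. T' x + s c x) \<and> range T' \<subseteq> span G)"
  using assms
proof (induction S)
  case (insert T S)
  then obtain G where G: "finite G"
    "\<forall>T\<in>S. \<exists>T'\<in>finite_rank_operators s. \<exists>c. T = (\<lambda>x. T' x + s c x) \<and> range T' \<subseteq> span G"
    by auto
  obtain T' c where T: "T = (\<lambda>x. T' x + s c x)" "T' \<in> finite_rank_operators s"
    using insert.prems unfolding finite_rank_unitization_simps by blast
  from T(2) obtain H where H: "finite H" "\<And>x. T' x \<in> span H"
    by (elim finite_rank_operatorsE) blast
  have "span G \<subseteq> span (G \<union> H)" "range T' \<subseteq> span (G \<union> H)"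
    using H span_mono[of H "G \<union> H"] span_mono[of G "G \<union> H"] by auto
  note spans = this
  show ?case
  proof (intro exI[of _ "G \<union> H"] conjI ballI)
    show "finite (G \<union> H)" using G(1) H(1) by simp
    fix R assume "R \<in> insert T S"
    then consider "R = T" | "R \<in> S" by blast
    then show "\<exists>T'\<in>finite_rank_operators s. \<exists>c. R = (\<lambda>x. T' x + s c x) \<and> range T' \<subseteq> span (G \<union> H)"
    proof cases
      case 1
      then show ?thesis
        by (intro bexI[of _ T'] exI[of _ c] conjI) (simp_all only: T spans)
    next
      case 2
      from bspec[OF G(2) this] obtain R' d where "R' \<in> finite_rank_operators s"
        "R = (\<lambda>x. R' x + s d x)" "range R' \<subseteq> span G"
        by (elim bexE exE conjE)
      then show ?thesis
        using spans(1) by (intro bexI[of _ R'] exI[of _ d] conjI) (simp_all only: subset_trans)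
    qed
  qed
qed auto

end

lemma D_Lie_eq_M_Lie_finite_rank_unitization:
  fixes s :: "complex \<Rightarrow> 'x::ab_group_add \<Rightarrow> 'x"
    and scale :: "complex \<Rightarrow> 'v::ab_group_add \<Rightarrow> 'v"
  assumes "vector_space s" and "unital_bimodule (finite_rank_unitization s) scale lact ract"
  shows "D_Lie (finite_rank_unitization s) scale lact ract = M_Lie (finite_rank_unitization s) lact ract"
proof -
  interpret X: vector_space s by fact
  interpret unital_bimodule "finite_rank_unitization s" scale lact ract by fact
  obtain \<beta> where \<beta>: "X.independent \<beta>" "X.span \<beta> = UNIV"
    using X.basis_exists[of UNIV] by (metis top.extremum_uniqueI)
  interpret vector_space_basis s \<beta>
    by unfold_locales (use \<beta> in auto)
  show ?thesis
  proof (cases "\<beta> = {}")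
    \<comment> \<open>For X = 0 the basis offers no minimal idempotent. The algebra is zero, and so
      is every unital bimodule, because its unit acts as zero.\<close>
    case True
    then have X_trivial: "x = 0" for x :: 'x
      by (metis \<beta>(2) True X.span_empty UNIV_I singletonD)
    then have one_zero: "\<one>\<^bsub>finite_rank_unitization s\<^esub> = \<zero>\<^bsub>finite_rank_unitization s\<^esub>"
      unfolding finite_rank_unitization_simps by (simp add: fun_eq_iff)
    have V_trivial: "v = 0" for v :: 'v
    proof -
      have "v = lact \<zero>\<^bsub>finite_rank_unitization s\<^esub> v"
        using lact_one[of v] by (simp only: one_zero)
      also have "\<dots> = 0"
        using lact_smult[of "\<zero>\<^bsub>finite_rank_unitization s\<^esub>" 0 v] by simp
      finally show ?thesis .
    qed
    have "T = 0" for T :: "'v \<Rightarrow> 'v"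
      using V_trivial by (simp add: fun_eq_iff)
    then show ?thesis
      using D_subset_M D_zero by (metis equalityI subsetI)
  next
    case False
    then obtain e where e: "e \<in> \<beta>" by blast
    let ?F = "finite_rank_unitization s"
    let ?p = "op_unit e e"
    interpret bimodule_minimal_idempotent ?F scale lact ract ?p
      by (intro bimodule_minimal_idempotent.intro assms minimal_idempotent_finite_rank_unitization e)
    show ?thesis
    proof (rule D_eq_M_if_local_units)
      fix S assume S: "finite S" "S \<subseteq> carrier ?F"
      obtain G where G: "finite G"
        "\<forall>T\<in>S. \<exists>T'\<in>finite_rank_operators s. \<exists>c. T = (\<lambda>x. T' x + s c x) \<and> range T' \<subseteq> X.span G"
        using common_finite_range[OF S] by blast
      \<comment> \<open>The basis vectors that occur in the generators G. E below is the coordinate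
        projection on their span, and so it fixes the span of G.\<close>
      define J where "J = (\<Union>x\<in>G. {b. rep x b \<noteq> 0})"
      have J: "finite J" "J \<subseteq> \<beta>"
        using G(1) X.finite_representation X.representation_ne_zero by (auto simp: J_def)
      have XY: "op_unit b e \<in> Ap" "op_unit e b \<in> pA" if "b \<in> J" for b
        unfolding Ap_def pA_def finite_rank_unitization_simps(2) using e by (simp_all add: op_unit_mult)
      define E where "E = (\<Oplus>\<^bsub>?F\<^esub>b\<in>J. op_unit b e \<otimes>\<^bsub>?F\<^esub> op_unit e b)"
      have E_eq: "E = (\<lambda>x. \<Sum>b\<in>J. s (rep x b) b)"
        unfolding E_def finite_rank_unitization_simps(2) op_unit_mult[OF e] using J
        by (simp add: finsum_finite_rank_unitization) (simp add: op_unit_def)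
      have E_carrier: "E \<in> carrier ?F"
        unfolding E_def by (rule A.finsum_closed) auto
      have E_G: "E x = x" if "x \<in> X.span G" for x
      proof -
        have "X.subspace {x. E x = x}"
          using carrier_linear[OF E_carrier] by (auto simp: X.subspace_def X.operator_simps)
        moreover have "G \<subseteq> {x. E x = x}"
          unfolding E_eq using J(1) by (auto intro!: sum_rep simp: J_def)
        ultimately show ?thesis
          using X.span_minimal that by blast
      qed
      have E_X: "E \<otimes>\<^bsub>?F\<^esub> op_unit b e = op_unit b e" if "b \<in> J" for b
      proof -
        have "E b = b"
          unfolding E_eq using that J by (intro sum_rep) (auto simp: rep_basis split: if_splits)
        then show ?thesis
          using X.operator_simps(2)[OF carrier_linear[OF E_carrier]]
          by (simp add: finite_rank_unitization_simps(2) fun_eq_iff op_unit_def)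
      qed
      have split: "\<exists>T'\<in>carrier ?F. \<exists>c. E \<otimes>\<^bsub>?F\<^esub> T' = T' \<and> T = T' \<oplus>\<^bsub>?F\<^esub> c \<odot>\<^bsub>?F\<^esub> \<one>\<^bsub>?F\<^esub>"
        if T: "T \<in> S" for T
      proof -
        obtain T' c where T': "T' \<in> finite_rank_operators s" "T = (\<lambda>x. T' x + s c x)" "range T' \<subseteq> X.span G"
          using bspec[OF G(2) T] by blast
        have "T' \<in> carrier ?F"
          unfolding finite_rank_unitization_simps
          by (intro CollectI exI[of _ T'] exI[of _ 0]) (simp add: T'(1))
        moreover have "E \<otimes>\<^bsub>?F\<^esub> T' = T'"
          using T'(3) E_G by (auto simp: finite_rank_unitization_simps(2) fun_eq_iff)
        moreover have "T = T' \<oplus>\<^bsub>?F\<^esub> c \<odot>\<^bsub>?F\<^esub> \<one>\<^bsub>?F\<^esub>"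
          by (simp add: finite_rank_unitization_simps(3,5,6) T'(2))
        ultimately show ?thesis by blast
      qed
      show "\<exists>(I :: 'x set) X Y. finite I \<and>
        (\<forall>i\<in>I. X i \<in> Ap \<and> Y i \<in> pA \<and> (\<Oplus>\<^bsub>?F\<^esub>i\<in>I. X i \<otimes>\<^bsub>?F\<^esub> Y i) \<otimes>\<^bsub>?F\<^esub> X i = X i) \<and>
        (\<forall>a\<in>S. \<exists>a'\<in>carrier ?F. \<exists>\<alpha>. (\<Oplus>\<^bsub>?F\<^esub>i\<in>I. X i \<otimes>\<^bsub>?F\<^esub> Y i) \<otimes>\<^bsub>?F\<^esub> a' = a'
          \<and> a = a' \<oplus>\<^bsub>?F\<^esub> \<alpha> \<odot>\<^bsub>?F\<^esub> \<one>\<^bsub>?F\<^esub>)"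
        by (rule exI[of _ J], rule exI[of _ "\<lambda>b. op_unit b e"], rule exI[of _ "\<lambda>b. op_unit e b"],
            fold E_def) (intro conjI ballI J XY E_X split)
    qed
  qed
qed

theorem corollary2p14:
  fixes scaleX :: "complex \<Rightarrow> 'x::ab_group_add \<Rightarrow> 'x"
    and B :: "(complex, 'b) module"
    and scale :: "complex \<Rightarrow> 'v::ab_group_add \<Rightarrow> 'v"
  shows "(\<forall>n\<ge>1. \<forall>lact ract.
            unital_bimodule (matrix_algebra n) scale lact ract \<longrightarrow>
            D_Lie (matrix_algebra n) scale lact ract = M_Lie (matrix_algebra n) lact ract)
       \<and> (vector_space scaleX \<longrightarrow> (\<forall>lact ract.
            unital_bimodule (finite_rank_unitization scaleX) scale lact ract \<longrightarrow>
            D_Lie (finite_rank_unitization scaleX) scale lact ract =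
              M_Lie (finite_rank_unitization scaleX) lact ract))
       \<and> (unital_algebra B \<and> singly_generated B \<longrightarrow> (\<forall>lact ract.
            unital_bimodule B scale lact ract \<longrightarrow>
            D_Lie B scale lact ract = M_Lie B lact ract))"
  using D_Lie_eq_M_Lie_matrix_algebra D_Lie_eq_M_Lie_finite_rank_unitization
    unital_bimodule.D_subset_M unital_bimodule.M_subset_D_if_singly_generated
  by (intro conjI allI impI equalityI) blast+

end
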